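(* Let $f_0(x)=1-s|x-1/2|$, $x\in[0,1]$, where $s=2-s_0$ with $0\le s_0<1$, and let $g$ be a $C^2$-smooth function on $[0,1]$ such that $f(x)=f_0(x)+g(x)\in[0,1]$ for each $x\in[0,1]$. Consider the system on $[0,1]^2$ $$T:\quad x_1(n+1)=(1-c)f(x_1(n))+cf(x_2(n)),\qquad x_2(n+1)=cf(x_1(n))+(1-c)f(x_2(n)).$$ There exist three small constants $c_+,s_{0+},\eta>0$ (not depending on $c$, $s_0$, $g$; in particular $c_+\le 1$) such that if $0\le c<c_+$, $s_0\le s_{0+}$ and $\|g\|_{C^2}<\eta$, then there exists a constant $\gamma_0>0$ such that for Lebesgue almost every initial point $(x_1(0),x_2(0))\in[0,1]^2$, $$\liminf_{n\to\infty}\mathrm{dist}(\mathbf{x}(n),D_{\mathrm{syn}})=0\quad\text{and}\quad \limsup_{n\to\infty}\mathrm{dist}(\mathbf{x}(n),D_{\mathrm{syn}})\ge\gamma_0,$$ where $\mathbf{x}(n)=(x_1(n),x_2(n))$.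
   Context: $D_{\mathrm{syn}}=\{(x_1,x_2)\in[0,1]^2: x_1=x_2\}$ and $\mathrm{dist}$ is the Euclidean distance from a point to a set. $\|g\|_{C^2}$ is the usual $C^2$ norm on $[0,1]$ (suprema of $|g|,|g'|,|g''|$). *)

theory Defs
  imports "HOL-Analysis.Analysis"
begin

text \<open>The derivative is taken within \<open>S\<close>, hence one-sided at the endpoints of an interval; values of
  \<open>g\<close> outside \<open>S\<close> play no role.\<close>

definition deriv_within :: "real set \<Rightarrow> (real \<Rightarrow> real) \<Rightarrow> real \<Rightarrow> real" where
  "deriv_within S g x = vector_derivative g (at x within S)"

definition C2_on :: "real set \<Rightarrow> (real \<Rightarrow> real) \<Rightarrow> bool" where
  "C2_on S g \<longleftrightarrow>
     g differentiable_on S \<and>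
     deriv_within S g differentiable_on S \<and>
     continuous_on S (deriv_within S (deriv_within S g))"

text \<open>The suprema are taken in the reals, so this is only meaningful where they are finite, in
  particular for \<open>g\<close> of class \<open>C\<^sup>2\<close> on a compact interval.\<close>

definition C2_norm :: "real set \<Rightarrow> (real \<Rightarrow> real) \<Rightarrow> real" where
  "C2_norm S g =
     Max {SUP x\<in>S. \<bar>g x\<bar>,
          SUP x\<in>S. \<bar>deriv_within S g x\<bar>,
          SUP x\<in>S. \<bar>deriv_within S (deriv_within S g) x\<bar>}"

definition tent :: "real \<Rightarrow> real \<Rightarrow> real" where
  "tent s x = 1 - s * \<bar>x - 1/2\<bar>"

definition coupled_map :: "real \<Rightarrow> (real \<Rightarrow> real) \<Rightarrow> real \<times> real \<Rightarrow> real \<times> real" where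
  "coupled_map c f = (\<lambda>(x1, x2). ((1 - c) * f x1 + c * f x2, c * f x1 + (1 - c) * f x2))"

definition unit_square :: "(real \<times> real) set" where
  "unit_square = {0..1} \<times> {0..1}"

definition D_syn :: "(real \<times> real) set" where
  "D_syn = {(x1, x2) \<in> unit_square. x1 = x2}"

end

theory Submission
  imports Defs
begin

text \<open>On each quadrant cut out by the lines \<open>x\<^sub>1 = 1/2\<close> and \<open>x\<^sub>2 = 1/2\<close> the map expands the sup norm by a factor
  close to 2. For a small box \<open>U\<close> let \<open>r\<^sub>n(x)\<close> be a radius such that the sup-norm ball of that radius about
  \<open>T\<^sup>n x\<close> lies in the image of the itinerary domain of \<open>x\<close>, and call the integral over \<open>U\<close> of the power \<open>-1/4\<close> of
  \<open>r\<^sub>n\<close> the energy. Expansion multiplies the energy by about \<open>2 powr (-1/4)\<close> per step, while a cut along a singular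
  line costs a factor of at most \<open>2 powr (1/4)\<close>, paid only near the line. A coordinate near \<open>1/2\<close> is sent near \<open>1\<close> and
  then near \<open>0\<close>, so within four steps each line cuts at most once and the energy contracts, up to a multiple of the area
  of \<open>U\<close>. Hence at some time most points of \<open>U\<close> have images of a universal size. With bounded distortion, a closed
  forward invariant set of positive area therefore contains a cell of a universal grid. For small parameters the 50th
  iterate is uniformly close to a product of two iterated full tent maps, which spreads every grid cell over the
  square; so neither the set of orbits staying away from the diagonal by a fixed distance nor the set of orbits staying
  close to it can have positive area.\<close>

subsection \<open>One-dimensional cutting cost\<close>

text \<open>For an exponent -a the ideal gain per step, 2^-a, and the worst factor of a cut, 2^a,
  cancel exactly, so no choice of exponent lets expansion beat even one cut per step, and two lines
  can cut at once. With the constants below, the one-step bound is about 0.85 times 1.4, which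
  exceeds 1. Over four steps the gain is 10/19 and each line is charged 0.2 once, against the final
  energy: (10/19) / (1 - 0.4) = 50/57 < 1, while the same quotient for three steps exceeds 1. The
  exponent 1/4 makes the four-step gain rational and goes with thresholds that are fourth powers:
  1/256 = 4^-4 and \<open>grid\<close> = 4000^4. Since the additive error is proportional to the
  area of \<open>U\<close>, the long-time bound relative to that area is universal. This fixes the
  constants in the order energy bound, \<open>grid\<close>, 50 iterates, parameters below 2^-60.
  Only the size of the holes that an invariant set leaves in the grid cells depends on the set;
  since a fixed fraction then escapes from boxes of every size, this still contradicts the existence
  of boxes that the set almost fills.\<close>

lemma nn_integral_powr_neg_quarter:
  fixes l :: real assumes "0 < l"
  shows "(\<integral>\<^sup>+u\<in>{0<..<l}. ennreal (u powr (-1/4)) \<partial>lborel) = ennreal (4/3 * l powr (3/4))"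
proof -
  have hi: "((\<lambda>x. x powr (-1/4)) has_integral (l powr (3/4) / (3/4))) {0..l}"
    using has_integral_powr_from_0[of "-1/4" l] assms by simp
  have "(\<integral>\<^sup>+u\<in>{0<..<l}. ennreal (u powr (-1/4)) \<partial>lborel) = (\<integral>\<^sup>+u\<in>{0..l}. ennreal (u powr (-1/4)) \<partial>lborel)"
  proof (rule nn_integral_cong_AE)
    show "AE x in lborel. ennreal (x powr (-1/4)) * indicator {0<..<l} x = ennreal (x powr (-1/4)) * indicator {0..l} x"
      using AE_lborel_singleton[of 0] AE_lborel_singleton[of l]
      by eventually_elim (auto simp: indicator_def)
  qed
  also have "\<dots> = ennreal (l powr (3/4) / (3/4))"
    using nn_integral_has_integral_lebesgue'[OF _ hi] by simp
  finally show ?thesis by simp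
qed

lemma nn_integral_lborel_shift:
  fixes f :: "real \<Rightarrow> ennreal"
  assumes [measurable]: "f \<in> borel_measurable borel"
  shows "(\<integral>\<^sup>+x. f (t + x) \<partial>lborel) = (\<integral>\<^sup>+x. f x \<partial>lborel)"
  using nn_integral_real_affine[of f 1 t] by simp

lemma nn_integral_lborel_reflect:
  fixes f :: "real \<Rightarrow> ennreal"
  assumes [measurable]: "f \<in> borel_measurable borel"
  shows "(\<integral>\<^sup>+x. f (t - x) \<partial>lborel) = (\<integral>\<^sup>+x. f x \<partial>lborel)"
  using nn_integral_real_affine[of f "-1" t] by simp

lemma two_powr_quarter_le: "2 powr (1/4) \<le> (1.19::real)"
proof -
  have "(2::real) powr (1/4) \<le> (1.19 powr 4) powr (1/4)"
    by (intro powr_mono2) (simp_all add: power_numeral_even)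
  also have "\<dots> = 1.19"
    unfolding powr_powr by simp
  finally show ?thesis .
qed

text \<open>Think of \<open>u\<close> as the distance to a new cut and of \<open>l - u\<close> as
  that to the old boundary; truncated subtraction in \<open>ennreal\<close> keeps the positive part.
  Adding the right-hand integral produces the integral of the larger power, that is twice the
  integral of \<open>u powr (-1/4)\<close> over half the interval, which gives the factor 2 powr
  (1/4) <= 1.19.\<close>

lemma nn_integral_powr_diff_le:
  fixes l :: real assumes l: "0 < l"
  shows "(\<integral>\<^sup>+u\<in>{0<..<l}. (ennreal (u powr (-1/4)) - ennreal ((l - u) powr (-1/4))) \<partial>lborel)
     \<le> ennreal 0.19 * (\<integral>\<^sup>+u\<in>{0<..<l}. ennreal ((l - u) powr (-1/4)) \<partial>lborel)" (is "?D \<le> _ * ?R")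
proof -
  have refl: "(\<integral>\<^sup>+u. ennreal ((l-u) powr (-1/4)) * indicator A (l - u) \<partial>lborel) = (\<integral>\<^sup>+u\<in>A. ennreal (u powr (-1/4)) \<partial>lborel)"
    if [measurable]: "A \<in> sets borel" for A
    by (rule nn_integral_lborel_reflect[of "\<lambda>u. ennreal (u powr (-1/4)) * indicator A u" l]) measurable
  have ind: "indicator {0<..<l} (l-u) = (indicator {0<..<l} u :: ennreal)" for u by (auto simp: indicator_def)
  have R: "?R = ennreal (4/3 * l powr (3/4))"
    using refl[of "{0<..<l}"] nn_integral_powr_neg_quarter[OF l] by (simp add: ind)
  have "?D + ?R = (\<integral>\<^sup>+u. (ennreal (u powr (-1/4)) - ennreal ((l - u) powr (-1/4))) * indicator {0<..<l} u
        + ennreal ((l - u) powr (-1/4)) * indicator {0<..<l} u \<partial>lborel)"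
    by (rule nn_integral_add[symmetric]) measurable
  also have "\<dots> \<le> (\<integral>\<^sup>+u. ennreal (u powr (-1/4)) * indicator {0<..<l/2} u
        + ennreal ((l - u) powr (-1/4)) * indicator {0<..<l/2} (l - u) \<partial>lborel)"
  proof (rule nn_integral_mono_AE)
    show "AE u in lborel. (ennreal (u powr (-1/4)) - ennreal ((l - u) powr (-1/4))) * indicator {0<..<l} u
        + ennreal ((l - u) powr (-1/4)) * indicator {0<..<l} u \<le>
        ennreal (u powr (-1/4)) * indicator {0<..<l/2} u
        + ennreal ((l - u) powr (-1/4)) * indicator {0<..<l/2} (l - u)"
      using AE_lborel_singleton[of "l/2"]
    proof eventually_elim
      case (elim u)
      consider "u \<le> 0 \<or> u \<ge> l" | "0 < u" "u < l/2" | "l/2 < u" "u < l" using elim by linarith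
      then show ?case
      proof cases
        case 1 then show ?thesis by (auto simp: indicator_def)
      next
        case 2
        have "(l - u) powr (-1/4) \<le> u powr (-1/4)" using 2 by (intro powr_mono2') auto
        then show ?thesis using 2 by (auto simp: indicator_def diff_add_cancel_ennreal ennreal_leI)
      next
        case 3
        have "u powr (-1/4) \<le> (l - u) powr (-1/4)" using 3 by (intro powr_mono2') auto
        then show ?thesis using 3 by (auto simp: indicator_def diff_eq_0_ennreal ennreal_leI)
      qed
    qed
  qed
  also have "\<dots> = (\<integral>\<^sup>+u. ennreal (u powr (-1/4)) * indicator {0<..<l/2} u \<partial>lborel)
        + (\<integral>\<^sup>+u. ennreal ((l - u) powr (-1/4)) * indicator {0<..<l/2} (l - u) \<partial>lborel)"
    by (rule nn_integral_add) measurable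
  also have "\<dots> = ennreal (4/3 * (l/2) powr (3/4)) + ennreal (4/3 * (l/2) powr (3/4))"
    using nn_integral_powr_neg_quarter[of "l/2"] l refl[of "{0<..<l/2}"] by simp
  also have "\<dots> = ennreal (2 powr (1/4) * (4/3 * l powr (3/4)))"
  proof -
    have "(2::real) powr (1/4) * 2 powr (3/4) = 2"
      by (simp add: powr_add[symmetric])
    then have "2 powr (1/4) * (4/3 * l powr (3/4)) = 8/3 * (l/2) powr (3/4)"
      using l by (simp add: powr_divide field_simps)
    then show ?thesis by (simp add: ennreal_plus[symmetric] del: ennreal_plus)
  qed
  also have "\<dots> \<le> ennreal (1.19 * (4/3 * l powr (3/4)))"
    by (intro ennreal_leI mult_right_mono two_powr_quarter_le) auto
  also have "\<dots> = ennreal 0.19 * ?R + ?R"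
    unfolding R by (simp add: ennreal_mult[symmetric] ennreal_plus[symmetric] del: ennreal_plus)
  finally have "?D + ?R \<le> ennreal 0.19 * ?R + ?R" .
  then show ?thesis using R by simp
qed

text \<open>\<open>Q\<close> may have many components. Only the stretch from \<open>m\<close> to the
  first missing point \<open>q\<close> contributes, because beyond \<open>q\<close> the old boundary
  is already closer than the cut. If the window contains no missing point, the whole integral is
  charged to the constant term, by
  \<open>\<rho> powr (3/4) = \<rho> powr (-1/4) * \<rho>\<close>.\<close>

lemma slice_cut_right:
  fixes \<delta> :: "real \<Rightarrow> real"
  assumes O: "open Q" and [measurable]: "\<delta> \<in> borel_measurable borel"
    and pos: "\<And>y. y \<in> Q \<Longrightarrow> 0 < \<delta> y" and le: "\<And>y z. y \<in> Q \<Longrightarrow> z \<notin> Q \<Longrightarrow> \<delta> y \<le> \<bar>y - z\<bar>" and \<rho>: "0 < \<rho>"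
  shows "(\<integral>\<^sup>+y\<in>Q \<inter> {m<..<m+\<rho>}. (ennreal (\<bar>y - m\<bar> powr (-1/4)) - ennreal (\<delta> y powr (-1/4))) \<partial>lborel)
    \<le> (\<integral>\<^sup>+y\<in>Q \<inter> {m<..<m+\<rho>}. (ennreal 0.19 * ennreal (\<delta> y powr (-1/4)) + ennreal (4/3 * \<rho> powr (-1/4))) \<partial>lborel)"
  (is "?L \<le> ?R")
proof -
  have [measurable]: "Q \<in> sets borel" using O by simp
  let ?Z = "{y. y \<notin> Q \<and> m \<le> y \<and> y < m + \<rho>}"
  show ?thesis
  proof (cases "?Z = {}")
    case True
    then have sub: "{m<..<m+\<rho>} \<subseteq> Q" by (metis (mono_tags, lifting) Collect_empty_eq greaterThanLessThan_iff less_imp_le subsetI)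
    have "?L \<le> (\<integral>\<^sup>+y. ennreal ((y - m) powr (-1/4)) * indicator {0<..<\<rho>} (y - m) \<partial>lborel)"
      by (rule nn_integral_mono) (auto simp: indicator_def)
    also have "\<dots> = (\<integral>\<^sup>+y. ennreal (y powr (-1/4)) * indicator {0<..<\<rho>} y \<partial>lborel)"
      using nn_integral_lborel_shift[of "\<lambda>y. ennreal (y powr (-1/4)) * indicator {0<..<\<rho>} y" "-m"] by simp
    also have "\<dots> = ennreal (4/3 * \<rho> powr (3/4))" using \<rho> by (rule nn_integral_powr_neg_quarter)
    also have "\<dots> = ennreal (4/3 * \<rho> powr (-1/4)) * ennreal \<rho>"
    proof -
      have "\<rho> powr (3/4) = \<rho> powr (-1/4) * \<rho> powr 1" by (simp only: powr_add[symmetric]) simp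
      then show ?thesis using \<rho> by (simp add: ennreal_mult[symmetric])
    qed
    also have "\<dots> = (\<integral>\<^sup>+y\<in>{m<..<m+\<rho>}. ennreal (4/3 * \<rho> powr (-1/4)) \<partial>lborel)"
      using \<rho> by (subst nn_integral_cmult_indicator) auto
    also have "\<dots> \<le> ?R"
      using sub by (intro nn_integral_mono) (auto simp: indicator_def add_increasing)
    finally show ?thesis .
  next
    case False
    define q where "q = Inf {y. y \<notin> Q \<and> m \<le> y}"
    have ne: "{y. y \<notin> Q \<and> m \<le> y} \<noteq> {}" using False by auto
    have bdd: "bdd_below {y. y \<notin> Q \<and> m \<le> y}" by (rule bdd_belowI[of _ m]) auto
    have "{y. y \<notin> Q \<and> m \<le> y} = (-Q) \<inter> {m..}" by auto
    then have cl: "closed {y. y \<notin> Q \<and> m \<le> y}" using O by (simp add: closed_Int closed_Compl)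
    have qin: "q \<notin> Q" "m \<le> q" using closed_contains_Inf[OF ne bdd cl] unfolding q_def by auto
    have qmin: "q \<le> y" if "y \<notin> Q" "m \<le> y" for y unfolding q_def using that bdd by (intro cInf_lower) auto
    have ql: "q < m + \<rho>" using False qmin by fastforce
    have zero: "ennreal (\<bar>y - m\<bar> powr (-1/4)) - ennreal (\<delta> y powr (-1/4)) = 0" if "y \<in> Q" "m < y" "q < y" for y
    proof -
      have "\<delta> y \<le> y - m" using le[OF that(1) qin(1)] that qin(2) by simp
      then have "(y - m) powr (-1/4) \<le> \<delta> y powr (-1/4)" using pos[OF that(1)] by (intro powr_mono2') auto
      then show ?thesis using that by (simp add: diff_eq_0_ennreal ennreal_leI)
    qed
    show ?thesis
    proof (cases "q = m")
      case True
      have "?L = 0" using zero unfolding True by (subst nn_integral_0_iff_AE) (auto simp: indicator_def)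
      then show ?thesis by simp
    next
      case False
      let ?l = "q - m"
      have l: "0 < ?l" using False qin by simp
      have dle: "(q - y) powr (-1/4) \<le> \<delta> y powr (-1/4)" if "m < y" "y < q" for y
      proof -
        have "y \<in> Q" using qmin[of y] that by force
        then show ?thesis using le[OF _ qin(1), of y] pos[of y] that by (intro powr_mono2') auto
      qed
      let ?f = "\<lambda>u. (ennreal (u powr (-1/4)) - ennreal ((?l - u) powr (-1/4))) * indicator {0<..<?l} u"
      let ?g = "\<lambda>u. ennreal ((?l - u) powr (-1/4)) * indicator {0<..<?l} u"
      have "?L \<le> (\<integral>\<^sup>+y. ?f (-m + y) \<partial>lborel)"
      proof (rule nn_integral_mono, goal_cases)
        case (1 y)
        consider "y \<notin> Q \<inter> {m<..<m+\<rho>}" | "y \<in> Q" "m < y" "q < y" | "y \<in> Q" "m < y" "y < q"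
          using qin by force
        then show ?case
        proof cases
          case 3
          then show ?thesis using dle[of y] ql by (auto simp: indicator_def intro!: ennreal_minus_mono ennreal_leI)
        qed (use zero[of y] in \<open>auto simp: indicator_def\<close>)
      qed
      also have "\<dots> = (\<integral>\<^sup>+y. ?f y \<partial>lborel)" by (rule nn_integral_lborel_shift) measurable
      also have "\<dots> \<le> ennreal 0.19 * (\<integral>\<^sup>+y. ?g y \<partial>lborel)" by (rule nn_integral_powr_diff_le[OF l])
      also have "(\<integral>\<^sup>+y. ?g y \<partial>lborel) = (\<integral>\<^sup>+y. ?g (-m + y) \<partial>lborel)"
        by (rule nn_integral_lborel_shift[symmetric]) measurable
      also have "ennreal 0.19 * \<dots> = (\<integral>\<^sup>+y. ennreal 0.19 * ?g (-m + y) \<partial>lborel)"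
        by (rule nn_integral_cmult[symmetric]) measurable
      also have "\<dots> \<le> ?R"
      proof (rule nn_integral_mono, goal_cases)
        case (1 y)
        show ?case
        proof (cases "m < y \<and> y < q")
          case True
          then have "y \<in> Q" using qmin[of y] by force
          then show ?thesis using True dle[of y] ql
            by (auto simp: indicator_def intro!: add_increasing2 mult_left_mono ennreal_leI)
        qed (auto simp: indicator_def)
      qed
      finally show ?thesis .
    qed
  qed
qed

lemma slice_cut:
  fixes \<delta> :: "real \<Rightarrow> real"
  assumes O: "open Q" and [measurable]: "\<delta> \<in> borel_measurable borel"
    and pos: "\<And>y. y \<in> Q \<Longrightarrow> 0 < \<delta> y" and le: "\<And>y z. y \<in> Q \<Longrightarrow> z \<notin> Q \<Longrightarrow> \<delta> y \<le> \<bar>y - z\<bar>" and \<rho>: "0 < \<rho>"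
  shows "(\<integral>\<^sup>+y\<in>Q \<inter> {m-\<rho><..<m+\<rho>}. (ennreal (\<bar>y - m\<bar> powr (-1/4)) - ennreal (\<delta> y powr (-1/4))) \<partial>lborel)
    \<le> (\<integral>\<^sup>+y\<in>Q \<inter> {m-\<rho><..<m+\<rho>}. (ennreal 0.19 * ennreal (\<delta> y powr (-1/4)) + ennreal (4/3 * \<rho> powr (-1/4))) \<partial>lborel)"
  (is "(\<integral>\<^sup>+y\<in>_. ?f y \<partial>lborel) \<le> (\<integral>\<^sup>+y\<in>_. ?g y \<partial>lborel)")
proof -
  have [measurable]: "Q \<in> sets borel" using O by simp
  let ?A = "Q \<inter> {m<..<m+\<rho>}" and ?B = "Q \<inter> {m-\<rho><..<m}"
  have split: "(\<integral>\<^sup>+y\<in>Q \<inter> {m-\<rho><..<m+\<rho>}. F y \<partial>lborel) = (\<integral>\<^sup>+y\<in>?A. F y \<partial>lborel) + (\<integral>\<^sup>+y\<in>?B. F y \<partial>lborel)"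
    if [measurable]: "F \<in> borel_measurable borel" for F
  proof -
    have "(\<integral>\<^sup>+y\<in>Q \<inter> {m-\<rho><..<m+\<rho>}. F y \<partial>lborel) = (\<integral>\<^sup>+y. F y * indicator ?A y + F y * indicator ?B y \<partial>lborel)"
      using \<rho> by (intro nn_integral_cong_AE eventually_mono[OF AE_lborel_singleton[of m]]) (auto simp: indicator_def)
    then show ?thesis by (simp add: nn_integral_add)
  qed
  have [measurable]: "?f \<in> borel_measurable borel" "?g \<in> borel_measurable borel" by measurable
  have A: "(\<integral>\<^sup>+y\<in>?A. ?f y \<partial>lborel) \<le> (\<integral>\<^sup>+y\<in>?A. ?g y \<partial>lborel)"
    using assms by (rule slice_cut_right)
  \<comment> \<open>Reflection in 0 turns the left half of the window at \<open>m\<close> into the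
    right half of a window at \<open>-m\<close>.\<close>
  let ?\<delta> = "\<lambda>y. \<delta> (- y)" and ?Q = "uminus -` Q"
  have oQ: "open ?Q" using O by (intro open_vimage) (auto intro: continuous_intros)
  let ?C = "?Q \<inter> {-m<..< -m+\<rho>}"
  have B': "(\<integral>\<^sup>+y\<in>?C. (ennreal (\<bar>y - (-m)\<bar> powr (-1/4)) - ennreal (?\<delta> y powr (-1/4))) \<partial>lborel)
    \<le> (\<integral>\<^sup>+y\<in>?C. (ennreal 0.19 * ennreal (?\<delta> y powr (-1/4)) + ennreal (4/3 * \<rho> powr (-1/4))) \<partial>lborel)"
    using pos le \<rho> oQ
    by (intro slice_cut_right) (auto, metis abs_minus_commute minus_diff_eq minus_minus diff_minus_eq_add add.commute uminus_add_conv_diff)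
  have ind: "indicator ?C y = (indicator ?B (- y) :: ennreal)" for y by (auto simp: indicator_def)
  have ab: "\<bar>y - (-m)\<bar> = \<bar>- y - m\<bar>" for y by linarith
  have B: "(\<integral>\<^sup>+y\<in>?B. ?f y \<partial>lborel) \<le> (\<integral>\<^sup>+y\<in>?B. ?g y \<partial>lborel)"
    using B' nn_integral_lborel_reflect[of "\<lambda>y. ?f y * indicator ?B y" 0] nn_integral_lborel_reflect[of "\<lambda>y. ?g y * indicator ?B y" 0]
    unfolding ind ab by simp
  show ?thesis unfolding split[of ?f, simplified] split[of ?g, simplified]
    by (subst split, measurable, subst split, measurable, intro add_mono A B)
qed

subsection \<open>The coupled map and its affine-like branches\<close>

lemma nn_integral_lborel_pair:
  fixes G :: "real \<times> real \<Rightarrow> ennreal"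
  assumes [measurable]: "G \<in> borel_measurable borel"
  shows "(\<integral>\<^sup>+z. G z \<partial>lborel) = (\<integral>\<^sup>+x. \<integral>\<^sup>+y. G (x, y) \<partial>lborel \<partial>lborel)"
    and "(\<integral>\<^sup>+z. G z \<partial>lborel) = (\<integral>\<^sup>+y. \<integral>\<^sup>+x. G (x, y) \<partial>lborel \<partial>lborel)"
proof -
  have m: "G \<in> borel_measurable (lborel \<Otimes>\<^sub>M lborel)" using assms by (simp add: lborel_prod)
  show 1: "(\<integral>\<^sup>+z. G z \<partial>lborel) = (\<integral>\<^sup>+x. \<integral>\<^sup>+y. G (x, y) \<partial>lborel \<partial>lborel)"
    using lborel.nn_integral_fst[OF m] by (simp add: lborel_prod)
  show "(\<integral>\<^sup>+z. G z \<partial>lborel) = (\<integral>\<^sup>+y. \<integral>\<^sup>+x. G (x, y) \<partial>lborel \<partial>lborel)"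
    unfolding 1 using lborel_pair.Fubini'[of "\<lambda>x y. G (x, y)"] m by simp
qed

lemma expanding_diffeo:
  fixes \<phi> \<phi>' :: "real \<Rightarrow> real"
  assumes d: "\<And>x. (\<phi> has_real_derivative \<phi>' x) (at x)" and c': "continuous_on UNIV \<phi>'" and k: "0 < k" "\<And>x. k \<le> \<phi>' x"
  shows expanding_diffeo_le: "x \<le> y \<Longrightarrow> k * (y - x) \<le> \<phi> y - \<phi> x"
    and expanding_diffeo_surj: "\<exists>x. \<phi> x = y"
    and expanding_diffeo_nn_integral: "g \<in> borel_measurable borel \<Longrightarrow> (\<integral>\<^sup>+x. g (\<phi> x) * ennreal (\<phi>' x) \<partial>lborel) = (\<integral>\<^sup>+x. g x \<partial>lborel)"
proof -
  show mono: "k * (y - x) \<le> \<phi> y - \<phi> x" if "x \<le> y" for x y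
  proof -
    have "((\<lambda>x. \<phi> x - k * x) has_real_derivative (\<phi>' z - k)) (at z)" for z
      by (auto intro!: derivative_eq_intros d)
    then have "\<phi> x - k * x \<le> \<phi> y - k * y"
      using that k(2) by (intro DERIV_nonneg_imp_nondecreasing[of x y "\<lambda>x. \<phi> x - k * x"]) (auto, metis diff_ge_0_iff_ge)
    then show ?thesis by (simp add: algebra_simps)
  qed
  have cont: "continuous_on A \<phi>" for A
    using d by (meson DERIV_isCont continuous_at_imp_continuous_on)
  have surj: "\<exists>x. \<phi> x = y" for y
  proof -
    define m where "m = \<bar>y - \<phi> 0\<bar> / k"
    have m0: "m \<ge> 0" unfolding m_def using k by simp
    have "\<phi> (-m) \<le> y" "y \<le> \<phi> m"
      using mono[of "-m" 0] mono[of 0 m] m0 k(1) by (auto simp: m_def)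
    then show ?thesis using IVT'[of \<phi> "-m" y m] m0 cont by auto
  qed
  then show "\<exists>x. \<phi> x = y" for y .
  have less: "\<phi> x < \<phi> y \<longleftrightarrow> x < y" for x y
  proof
    assume "x < y" then have "0 < k * (y - x)" using k by simp
    then show "\<phi> x < \<phi> y" using mono[of x y] \<open>x < y\<close> by linarith
  next
    assume l: "\<phi> x < \<phi> y" show "x < y"
    proof (rule ccontr)
      assume "\<not> x < y" then have "y \<le> x" by simp
      then have "0 \<le> k * (x - y)" using k by simp
      then show False using mono[OF \<open>y \<le> x\<close>] l by linarith
    qed
  qed
  have [measurable]: "\<phi> \<in> borel_measurable borel" "\<phi>' \<in> borel_measurable borel"
    using cont c' by (auto intro: borel_measurable_continuous_onI)
  \<comment> \<open>Intervals determine Lebesgue measure, and for an interval the identity is the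
    fundamental theorem of calculus; substitution then follows for every nonnegative Borel
    function.\<close>
  have eq: "lborel = distr (density lborel \<phi>') borel \<phi>"
  proof (rule lborel_eqI)
    fix l u :: real assume lu: "\<And>b. b \<in> Basis \<Longrightarrow> l \<bullet> b \<le> u \<bullet> b"
    obtain a b where ab: "\<phi> a = l" "\<phi> b = u" using surj by metis
    have "l \<le> u" using lu[of 1] by simp
    then have "a \<le> b" using less[of b a] ab by linarith
    have v: "\<phi> -` {l<..<u} = {a<..<b}" using ab less by auto
    have "emeasure (distr (density lborel \<phi>') borel \<phi>) (box l u) = (\<integral>\<^sup>+x. ennreal (\<phi>' x) * indicator {a<..<b} x \<partial>lborel)"
      by (simp add: emeasure_distr emeasure_density v box_real)
    also have "\<dots> = (\<integral>\<^sup>+x. ennreal (\<phi>' x) * indicator {a..b} x \<partial>lborel)"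
      by (rule nn_integral_cong_AE, use AE_lborel_singleton[of a] AE_lborel_singleton[of b] in eventually_elim)
        (auto simp: indicator_def)
    also have "\<dots> = \<phi> b - \<phi> a"
      by (rule nn_integral_FTC_Icc) (use d k \<open>a \<le> b\<close> in \<open>auto intro: order_trans[OF less_imp_le]\<close>)
    finally show "emeasure (distr (density lborel \<phi>') borel \<phi>) (box l u) = (\<Prod>b\<in>Basis. (u - l) \<bullet> b)"
      using ab by simp
  qed simp
  show "(\<integral>\<^sup>+x. g (\<phi> x) * ennreal (\<phi>' x) \<partial>lborel) = (\<integral>\<^sup>+x. g x \<partial>lborel)" if [measurable]: "g \<in> borel_measurable borel"
    by (subst (2) eq) (simp add: nn_integral_distr nn_integral_density mult.commute)
qed

definition supd :: "real \<times> real \<Rightarrow> real \<times> real \<Rightarrow> real" where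
  "supd x y = max \<bar>fst x - fst y\<bar> \<bar>snd x - snd y\<bar>"

text \<open>\<open>True\<close> marks the side below 1/2, where the tent increases. Strict
  inequalities make the quadrants open, at the price of the exceptional null set
  \<open>cross\<close>.\<close>

definition quadrant :: "bool \<times> bool \<Rightarrow> (real \<times> real) set" where
  "quadrant i = {x. (if fst i then fst x < 1/2 else 1/2 < fst x) \<and> (if snd i then snd x < 1/2 else 1/2 < snd x)}"

definition cross :: "(real \<times> real) set" where
  "cross = {x. fst x = 1/2 \<or> snd x = 1/2}"

lemma open_quadrant: "open (quadrant i)"
  unfolding quadrant_def
  by (cases "fst i"; cases "snd i") (auto intro!: open_Collect_conj open_Collect_less continuous_intros)

lemma mem_quadrant_iff: "x \<in> quadrant i \<longleftrightarrow> x \<notin> cross \<and> i = (fst x < 1/2, snd x < 1/2)"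
  unfolding quadrant_def cross_def by (cases "fst i"; cases "snd i") (auto simp: prod_eq_iff)

lemma AE_not_vertical: "AE x::real \<times> real in lborel. fst x \<noteq> a"
  and AE_not_horizontal: "AE x::real \<times> real in lborel. snd x \<noteq> a"
proof -
  have "{a} \<times> (UNIV::real set) \<in> null_sets (lborel \<Otimes>\<^sub>M lborel)" "(UNIV::real set) \<times> {a} \<in> null_sets (lborel \<Otimes>\<^sub>M lborel)"
    by (auto simp: null_sets_def lborel.emeasure_pair_measure_Times)
  then have *: "AE x::real \<times> real in lborel. x \<notin> {a} \<times> UNIV" "AE x::real \<times> real in lborel. x \<notin> UNIV \<times> {a}"
    by (auto intro!: AE_not_in simp: lborel_prod)
  show "AE x::real \<times> real in lborel. fst x \<noteq> a" using *(1) by eventually_elim auto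
  show "AE x::real \<times> real in lborel. snd x \<noteq> a" using *(2) by eventually_elim auto
qed

text \<open>\<open>h\<close> stands for an extension of \<open>g\<close> to the whole line, so that
  each branch becomes a diffeomorphism of the line. The Lipschitz condition on \<open>h'\<close>
  takes the place of a bound on the second derivative, since the extension may fail to be C2 at the
  endpoints. The crude 1/1000 is enough for the energy estimates; closeness to the full tent enters
  in \<open>nearly_full_tents\<close>.\<close>

locale coupled_tents =
  fixes c s :: real and h h' :: "real \<Rightarrow> real"
  assumes c_ge: "0 \<le> c" and c_le: "c \<le> 1/1000" and s_ge: "2 - 1/1000 \<le> s" and s_le: "s \<le> 2"
    and h_deriv: "\<And>x. (h has_real_derivative h' x) (at x)"
    and h'_le: "\<And>x. \<bar>h' x\<bar> \<le> 1/1000"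
    and h'_lipschitz: "\<And>x y. \<bar>h' x - h' y\<bar> \<le> 1/1000 * \<bar>x - y\<bar>"
    and h_le: "\<And>x. x \<in> {0..1} \<Longrightarrow> \<bar>h x\<bar> \<le> 1/1000"
    and range01: "\<And>x. x \<in> {0..1} \<Longrightarrow> tent s x + h x \<in> {0..1}"
begin

definition F :: "real \<Rightarrow> real" where "F x = tent s x + h x"
definition T :: "real \<times> real \<Rightarrow> real \<times> real" where "T = coupled_map c F"
definition branch :: "bool \<Rightarrow> real \<Rightarrow> real" where "branch b x = 1 + (if b then s else - s) * (x - 1/2) + h x"
definition dbranch :: "bool \<Rightarrow> real \<Rightarrow> real" where "dbranch b x = (if b then s else - s) + h' x"
text \<open>Each branch is extended beyond its quadrant to a bijection of the plane, so a point can
  be pulled back first and its quadrant checked afterwards.\<close>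

definition Tbr :: "bool \<times> bool \<Rightarrow> real \<times> real \<Rightarrow> real \<times> real" where
  "Tbr i x = ((1 - c) * branch (fst i) (fst x) + c * branch (snd i) (snd x),
             c * branch (fst i) (fst x) + (1 - c) * branch (snd i) (snd x))"
text \<open>\<open>1 - 2 * c\<close> is the determinant of the coupling matrix with rows (1-c, c)
  and (c, 1-c).\<close>

definition Jac :: "bool \<times> bool \<Rightarrow> real \<times> real \<Rightarrow> real" where
  "Jac i x = (1 - 2 * c) * (\<bar>dbranch (fst i) (fst x)\<bar> * \<bar>dbranch (snd i) (snd x)\<bar>)"

lemma continuous_h: "continuous_on A h"
  using h_deriv by (meson DERIV_isCont continuous_at_imp_continuous_on)

lemma continuous_h': "continuous_on A h'"
proof -
  have "(1/1000)-lipschitz_on A h'" using h'_lipschitz by (auto simp: lipschitz_on_def dist_real_def)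
  then show ?thesis by (rule lipschitz_on_continuous_on)
qed

lemma continuous_F: "continuous_on A F"
  unfolding F_def tent_def by (intro continuous_intros continuous_h)

lemma continuous_T: "continuous_on A T"
proof -
  have "T = (\<lambda>x. ((1 - c) * F (fst x) + c * F (snd x), c * F (fst x) + (1 - c) * F (snd x)))"
    by (auto simp: T_def coupled_map_def)
  moreover have "continuous_on A (\<lambda>x. F (fst x))" "continuous_on A (\<lambda>x. F (snd x))" for A :: "(real \<times> real) set"
    by (auto intro!: continuous_on_compose2[OF continuous_F[of UNIV]] continuous_intros)
  ultimately show ?thesis by (auto intro!: continuous_intros)
qed

lemma continuous_T_pow: "continuous_on A (T ^^ n)"
proof (induction n)
  case (Suc n)
  then show ?case using continuous_on_compose[OF Suc continuous_T] by simp
qed (simp add: continuous_on_id)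

lemma continuous_branch: "continuous_on A (branch b)"
  unfolding branch_def by (intro continuous_intros continuous_h)

lemma continuous_dbranch: "continuous_on A (dbranch b)"
  unfolding dbranch_def by (intro continuous_intros continuous_h')

lemma measurable_T[measurable]: "T \<in> borel_measurable borel"
  by (intro borel_measurable_continuous_onI continuous_T)
lemma measurable_T_pow[measurable]: "T ^^ n \<in> borel_measurable borel"
  by (intro borel_measurable_continuous_onI continuous_T_pow)
lemma measurable_branch[measurable]: "branch b \<in> borel_measurable borel"
  by (intro borel_measurable_continuous_onI continuous_branch)
lemma measurable_dbranch[measurable]: "dbranch b \<in> borel_measurable borel"
  by (intro borel_measurable_continuous_onI continuous_dbranch)
lemma measurable_Jac[measurable]: "Jac i \<in> borel_measurable borel"
  unfolding Jac_def borel_prod[symmetric] by measurable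
lemma measurable_Tbr[measurable]: "Tbr i \<in> borel_measurable borel"
  unfolding Tbr_def borel_prod[symmetric] by measurable

lemma F_branch: "x \<le> 1/2 \<Longrightarrow> F x = branch True x" "1/2 \<le> x \<Longrightarrow> F x = branch False x"
  unfolding F_def branch_def tent_def by (simp_all add: abs_if algebra_simps)

lemma T_alt: "T x = ((1 - c) * F (fst x) + c * F (snd x), c * F (fst x) + (1 - c) * F (snd x))"
  by (simp add: T_def coupled_map_def split_beta)

lemma T_eq_Tbr: "x \<in> quadrant i \<Longrightarrow> T x = Tbr i x"
proof -
  assume "x \<in> quadrant i"
  then have "F (fst x) = branch (fst i) (fst x)" "F (snd x) = branch (snd i) (snd x)"
    unfolding quadrant_def using F_branch by (cases "fst i"; cases "snd i"; force)+
  then show ?thesis unfolding T_alt Tbr_def by simp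
qed

lemma T_in_Tbr: "\<exists>i. T x = Tbr i x"
proof -
  have "F y = branch (y \<le> 1/2) y" for y using F_branch[of y] by (cases "y \<le> 1/2") auto
  then have "T x = Tbr (fst x \<le> 1/2, snd x \<le> 1/2) x" unfolding T_alt Tbr_def by simp
  then show ?thesis ..
qed

lemma branch_diffeo:
  shows branch_expand: "1998/1000 * \<bar>x - y\<bar> \<le> \<bar>branch b x - branch b y\<bar>"
    and branch_surj: "\<exists>x. branch b x = y"
    and nn_integral_branch: "g \<in> borel_measurable borel \<Longrightarrow>
      (\<integral>\<^sup>+x. g (branch b x) * ennreal \<bar>dbranch b x\<bar> \<partial>lborel) = (\<integral>\<^sup>+x. g x \<partial>lborel)"
proof -
  \<comment> \<open>The sign turns the decreasing branch into an increasing function, so that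
    \<open>expanding_diffeo\<close> covers both branches.\<close>
  define \<sigma> :: real where "\<sigma> = (if b then 1 else -1)"
  have \<sigma>: "\<sigma> * \<sigma> = 1" "\<bar>\<sigma>\<bar> = 1" unfolding \<sigma>_def by auto
  define \<phi> where "\<phi> x = \<sigma> * branch b x" for x
  define \<phi>' where "\<phi>' x = \<sigma> * dbranch b x" for x
  have d: "(\<phi> has_real_derivative \<phi>' x) (at x)" for x
    unfolding \<phi>_def \<phi>'_def branch_def dbranch_def by (auto intro!: derivative_eq_intros h_deriv simp: algebra_simps)
  have c': "continuous_on UNIV \<phi>'" unfolding \<phi>'_def by (intro continuous_intros continuous_dbranch)
  have k: "1998/1000 \<le> \<phi>' x" for x
    using h'_le[of x] s_ge unfolding \<phi>'_def dbranch_def \<sigma>_def by (auto simp: abs_le_iff)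
  have k0: "(0::real) < 1998/1000" by simp
  note E = expanding_diffeo[OF d c' k0 k]
  have br: "branch b x = \<sigma> * \<phi> x" for x unfolding \<phi>_def using \<sigma> by (simp add: mult.assoc[symmetric])
  have ab: "\<bar>dbranch b x\<bar> = \<phi>' x" for x using k[of x] unfolding \<phi>'_def \<sigma>_def by (auto split: if_splits)
  have "1998/1000 * \<bar>x - y\<bar> \<le> \<bar>\<phi> x - \<phi> y\<bar>" for x y
    using E(1)[of x y] E(1)[of y x] by (cases "x \<le> y") auto
  then show "1998/1000 * \<bar>x - y\<bar> \<le> \<bar>branch b x - branch b y\<bar>"
    unfolding br right_diff_distrib[symmetric] abs_mult \<sigma> by simp
  obtain x where "\<phi> x = \<sigma> * y" using E(2) by blast
  then have "branch b x = y" unfolding br using \<sigma> by (simp add: mult.assoc[symmetric])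
  then show "\<exists>x. branch b x = y" ..
  assume [measurable]: "g \<in> borel_measurable borel"
  have "(\<integral>\<^sup>+x. g (branch b x) * ennreal \<bar>dbranch b x\<bar> \<partial>lborel) = (\<integral>\<^sup>+x. g (\<sigma> * \<phi> x) * ennreal (\<phi>' x) \<partial>lborel)"
    unfolding ab br ..
  also have "\<dots> = (\<integral>\<^sup>+x. g (\<sigma> * x) \<partial>lborel)" by (rule E(3)) measurable
  also have "\<dots> = (\<integral>\<^sup>+x. g x \<partial>lborel)"
    using nn_integral_real_affine[of g \<sigma> 0] \<sigma> by (auto simp: \<sigma>_def split: if_splits)
  finally show "(\<integral>\<^sup>+x. g (branch b x) * ennreal \<bar>dbranch b x\<bar> \<partial>lborel) = (\<integral>\<^sup>+x. g x \<partial>lborel)" .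
qed

text \<open>A branch stretches by at least 1.998, and the coupling retains at least 0.998 of the
  larger coordinate difference, since the other one enters with weight at most 1/1000. The product
  exceeds 19/10.\<close>

lemma Tbr_expand: "19/10 * supd x y \<le> supd (Tbr i x) (Tbr i y)"
proof -
  have lin: "\<exists>z. (z = (1-c)*u + c * v \<or> z = c*u+(1-c) * v) \<and> 998/1000 * max \<bar>u\<bar> \<bar>v\<bar> \<le> \<bar>z\<bar>" for u v :: real
  proof -
    have main: "998/1000 * \<bar>a\<bar> \<le> \<bar>(1-c)*a + c*b\<bar>" if "\<bar>b\<bar> \<le> \<bar>a\<bar>" for a b
    proof -
      have "\<bar>c * b\<bar> \<le> c * \<bar>a\<bar>" "\<bar>(1-c)*a\<bar> = (1 - c) * \<bar>a\<bar>" using that c_ge c_le by (auto simp: abs_mult mult_left_mono)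
      moreover have "c * \<bar>a\<bar> \<le> 1/1000 * \<bar>a\<bar>" using c_le by (intro mult_right_mono) auto
      moreover have "\<bar>(1-c)*a + c*b\<bar> \<ge> \<bar>(1-c)*a\<bar> - \<bar>c*b\<bar>" by linarith
      ultimately show ?thesis by (simp add: algebra_simps)
    qed
    show ?thesis
    proof (cases "\<bar>v\<bar> \<le> \<bar>u\<bar>")
      case True then show ?thesis using main[of v u] by auto
    next
      case False then show ?thesis using main[of u v] by (auto simp: add.commute)
    qed
  qed
  let ?u = "branch (fst i) (fst x) - branch (fst i) (fst y)" and ?v = "branch (snd i) (snd x) - branch (snd i) (snd y)"
  have e: "1998/1000 * \<bar>fst x - fst y\<bar> \<le> \<bar>?u\<bar>" "1998/1000 * \<bar>snd x - snd y\<bar> \<le> \<bar>?v\<bar>" by (rule branch_expand)+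
  have "supd (Tbr i x) (Tbr i y) = max \<bar>(1-c)*?u + c * ?v\<bar> \<bar>c*?u+(1-c) * ?v\<bar>"
    unfolding supd_def Tbr_def by (simp add: algebra_simps)
  moreover have "998/1000 * max \<bar>?u\<bar> \<bar>?v\<bar> \<le> max \<bar>(1-c)*?u + c * ?v\<bar> \<bar>c*?u+(1-c) * ?v\<bar>"
    using lin[of ?u ?v] by (metis max.coboundedI1 max.coboundedI2)
  moreover have "1998/1000 * supd x y \<le> max \<bar>?u\<bar> \<bar>?v\<bar>" using e unfolding supd_def by linarith
  moreover have "0 \<le> supd x y" unfolding supd_def by simp
  ultimately show ?thesis by linarith
qed

lemma Tbr_inj: "Tbr i x = Tbr i y \<Longrightarrow> x = y"
  using Tbr_expand[of x y i] by (auto simp: supd_def prod_eq_iff)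

lemma Tbr_surj: "\<exists>x. Tbr i x = y"
proof -
  \<comment> \<open>The two branch values are obtained from the inverse of the coupling matrix,
    whose determinant is \<open>d\<close>.\<close>
  define d where "d = 1 - 2 * c"
  have d: "d \<noteq> 0" using c_le unfolding d_def by simp
  obtain x1 where x1: "branch (fst i) x1 = ((1-c) * fst y - c * snd y) / d" using branch_surj by blast
  obtain x2 where x2: "branch (snd i) x2 = ((1-c) * snd y - c * fst y) / d" using branch_surj by blast
  have u: "d * branch (fst i) x1 = (1-c) * fst y - c * snd y" and v: "d * branch (snd i) x2 = (1-c) * snd y - c * fst y"
    using d x1 x2 by auto
  have "d * ((1-c) * branch (fst i) x1 + c * branch (snd i) x2) = (1-c) * (d * branch (fst i) x1) + c * (d * branch (snd i) x2)"
    "d * (c * branch (fst i) x1 + (1-c) * branch (snd i) x2) = c * (d * branch (fst i) x1) + (1-c) * (d * branch (snd i) x2)"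
    by (simp_all add: algebra_simps)
  then have "d * ((1-c) * branch (fst i) x1 + c * branch (snd i) x2) = d * fst y"
    "d * (c * branch (fst i) x1 + (1-c) * branch (snd i) x2) = d * snd y"
    unfolding u v by (simp_all add: d_def algebra_simps)
  then have "Tbr i (x1, x2) = y"
    unfolding Tbr_def using d by (simp add: prod_eq_iff)
  then show ?thesis ..
qed

lemma nn_integral_Tbr:
  assumes [measurable]: "G \<in> borel_measurable borel"
  shows "(\<integral>\<^sup>+x. G (Tbr i x) * ennreal (Jac i x) \<partial>lborel) = (\<integral>\<^sup>+x. G x \<partial>lborel)"
proof -
  have [measurable]: "G \<in> borel_measurable (borel \<Otimes>\<^sub>M borel)" using assms by (simp add: borel_prod)
  define H where "H u v = G ((1-c)*u + c * v, c*u + (1-c) * v)" for u v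
  have [measurable]: "(\<lambda>(u,v). H u v) \<in> borel_measurable (borel \<Otimes>\<^sub>M borel)" unfolding H_def by measurable
  have [measurable]: "(\<lambda>x. G (Tbr i x) * ennreal (Jac i x)) \<in> borel_measurable borel" by measurable
  let ?d = "1 - 2 * c"
  have d: "0 < ?d" "0 < 1 - c" using c_le by auto
  have "(\<integral>\<^sup>+x. G (Tbr i x) * ennreal (Jac i x) \<partial>lborel)
    = (\<integral>\<^sup>+x1. \<integral>\<^sup>+x2. ennreal ?d * (ennreal \<bar>dbranch (fst i) x1\<bar> * (H (branch (fst i) x1) (branch (snd i) x2) * ennreal \<bar>dbranch (snd i) x2\<bar>)) \<partial>lborel \<partial>lborel)"
    by (subst nn_integral_lborel_pair(1), measurable)
      (use d in \<open>auto simp: Jac_def Tbr_def H_def ennreal_mult mult_ac intro!: nn_integral_cong\<close>)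
  also have "\<dots> = ennreal ?d * (\<integral>\<^sup>+x1. (\<integral>\<^sup>+x2. H (branch (fst i) x1) x2 \<partial>lborel) * ennreal \<bar>dbranch (fst i) x1\<bar>  \<partial>lborel)"
  proof -
    have "(\<integral>\<^sup>+x2. ennreal ?d * (ennreal \<bar>dbranch (fst i) x1\<bar> * (H (branch (fst i) x1) (branch (snd i) x2) * ennreal \<bar>dbranch (snd i) x2\<bar>)) \<partial>lborel)
      = ennreal ?d * (\<integral>\<^sup>+x2. H (branch (fst i) x1) x2 \<partial>lborel) * ennreal \<bar>dbranch (fst i) x1\<bar>" for x1
      using nn_integral_branch[of "H (branch (fst i) x1)" "snd i"]
      by (subst nn_integral_cmult, measurable, subst nn_integral_cmult, measurable) (simp add: mult_ac)
    then show ?thesis by (simp add: nn_integral_cmult mult.assoc)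
  qed
  also have "\<dots> = ennreal ?d * (\<integral>\<^sup>+x1. \<integral>\<^sup>+x2. H x1 x2 \<partial>lborel \<partial>lborel)"
    by (subst nn_integral_branch[of "\<lambda>x1. \<integral>\<^sup>+x2. H x1 x2 \<partial>lborel"]) simp_all
  \<comment> \<open>The linear coupling is substituted one coordinate at a time: with the second
    branch value fixed, the first output \<open>y1\<close> becomes the variable; then, with
    \<open>y1\<close> fixed, the second output \<open>y2\<close> does. The factors
    \<open>1/(1-c)\<close> and \<open>(1-c)/?d\<close> cancel \<open>?d\<close>.\<close>
  also have "\<dots> = ennreal ?d * (\<integral>\<^sup>+x2. \<integral>\<^sup>+x1. H x1 x2 \<partial>lborel \<partial>lborel)"
    by (subst lborel_pair.Fubini') simp_all
  also have "(\<integral>\<^sup>+x2. \<integral>\<^sup>+x1. H x1 x2 \<partial>lborel \<partial>lborel) = (\<integral>\<^sup>+x2. ennreal (1/(1-c)) * (\<integral>\<^sup>+y1. G (y1, c/(1-c) * y1 + ?d/(1-c) * x2) \<partial>lborel) \<partial>lborel)"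
  proof (rule nn_integral_cong)
    fix x2 :: real
    have m: "(\<lambda>u. H u x2) \<in> borel_measurable borel" by measurable
    have "H (- (c/(1-c)) * x2 + 1/(1-c) * y1) x2 = G (y1, c/(1-c) * y1 + ?d/(1-c) * x2)" for y1
    proof -
      let ?U = "- (c/(1-c)) * x2 + 1/(1-c) * y1" and ?V = "c/(1-c) * y1 + ?d/(1-c) * x2"
      have U: "(1-c) * ?U = y1 - c * x2" and V: "(1-c) * ?V = c * y1 + ?d * x2"
        using less_imp_neq[OF d(2)] by (simp_all add: distrib_left right_diff_distrib)
      have "(1-c) * (c * ?U + (1-c) * x2) = c * ((1-c) * ?U) + (1-c) * ((1-c) * x2)" by (simp only: distrib_left mult.left_commute)
      also have "\<dots> = (1-c) * ?V" unfolding U V by (simp add: algebra_simps)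
      finally have "c * ?U + (1-c) * x2 = ?V" using d(2) by simp
      then show ?thesis unfolding H_def U by simp
    qed
    then show "(\<integral>\<^sup>+x1. H x1 x2 \<partial>lborel) = ennreal (1/(1-c)) * (\<integral>\<^sup>+y1. G (y1, c/(1-c) * y1 + ?d/(1-c) * x2) \<partial>lborel)"
      using nn_integral_real_affine[OF m, of "1/(1-c)" "- (c/(1-c)) * x2"] d by simp
  qed
  also have "\<dots> = ennreal (1/(1-c)) * (\<integral>\<^sup>+x2. \<integral>\<^sup>+y1. G (y1, c/(1-c) * y1 + ?d/(1-c) * x2) \<partial>lborel \<partial>lborel)"
    by (rule nn_integral_cmult) measurable
  also have "(\<integral>\<^sup>+x2. \<integral>\<^sup>+y1. G (y1, c/(1-c) * y1 + ?d/(1-c) * x2) \<partial>lborel \<partial>lborel) =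
     (\<integral>\<^sup>+y1. \<integral>\<^sup>+x2. G (y1, c/(1-c) * y1 + ?d/(1-c) * x2) \<partial>lborel \<partial>lborel)"
    by (rule lborel_pair.Fubini') measurable
  also have "\<dots> = (\<integral>\<^sup>+y1. ennreal ((1-c)/?d) * (\<integral>\<^sup>+y2. G (y1, y2) \<partial>lborel) \<partial>lborel)"
  proof (rule nn_integral_cong)
    fix y1 :: real
    have m: "(\<lambda>v. G (y1, v)) \<in> borel_measurable borel" by measurable
    have "(\<integral>\<^sup>+y2. G (y1, y2) \<partial>lborel) = ennreal (?d/(1-c)) * (\<integral>\<^sup>+x2. G (y1, c/(1-c) * y1 + ?d/(1-c) * x2) \<partial>lborel)"
      using nn_integral_real_affine[OF m, of "?d/(1-c)" "c/(1-c) * y1"] d by simp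
    then show "(\<integral>\<^sup>+x2. G (y1, c/(1-c) * y1 + ?d/(1-c) * x2) \<partial>lborel) = ennreal ((1-c)/?d) * (\<integral>\<^sup>+y2. G (y1, y2) \<partial>lborel)"
      using d by (simp add: mult.assoc[symmetric] ennreal_mult[symmetric])
  qed
  also have "\<dots> = ennreal ((1-c)/?d) * (\<integral>\<^sup>+y1. \<integral>\<^sup>+y2. G (y1, y2) \<partial>lborel \<partial>lborel)"
    by (rule nn_integral_cmult) measurable
  also have "(\<integral>\<^sup>+y1. \<integral>\<^sup>+y2. G (y1, y2) \<partial>lborel \<partial>lborel) = (\<integral>\<^sup>+x. G x \<partial>lborel)"
    by (rule nn_integral_lborel_pair(1)[symmetric]) fact
  finally show ?thesis
    using d by (simp add: mult.assoc[symmetric] ennreal_mult[symmetric])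
qed

lemma Jac_pos: "0 < Jac i x"
proof -
  have "0 < \<bar>dbranch b y\<bar>" for b y using h'_le[of y] s_ge unfolding dbranch_def by (auto simp: abs_le_iff)
  then show ?thesis unfolding Jac_def using c_le by (intro mult_pos_pos) auto
qed

text \<open>At each point \<open>T\<close> coincides with one of four branches, and the change of
  variables with a positive Jacobian shows that every branch pulls null sets back to null
  sets.\<close>

lemma AE_T:
  assumes "AE y in lborel. P y" shows "AE x in lborel. P (T x)"
proof -
  obtain N where N: "N \<in> null_sets lborel" "{y. \<not> P y} \<subseteq> N" using assms by (auto elim!: AE_E2 simp: eventually_ae_filter)
  then have [measurable]: "N \<in> sets borel" by auto
  have *: "AE x in lborel. Tbr i x \<notin> N" for i
  proof -
    have "(\<integral>\<^sup>+x. indicator N (Tbr i x) * ennreal (Jac i x) \<partial>lborel) = (\<integral>\<^sup>+x. indicator N x \<partial>lborel)"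
      by (rule nn_integral_Tbr) measurable
    also have "\<dots> = 0" using N by auto
    finally have "AE x in lborel. indicator N (Tbr i x) * ennreal (Jac i x) = 0"
      by (subst (asm) nn_integral_0_iff_AE) auto
    then show ?thesis by eventually_elim (use Jac_pos[of i] in \<open>auto simp: indicator_def ennreal_eq_0_iff not_le[symmetric] split: if_splits\<close>)
  qed
  have "AE x in lborel. \<forall>i. Tbr i x \<notin> N" using * by (simp add: AE_all_countable)
  then show ?thesis by eventually_elim (metis (mono_tags, lifting) N(2) T_in_Tbr mem_Collect_eq subsetD)
qed

lemma AE_T_pow: "AE y in lborel. P y \<Longrightarrow> AE x in lborel. P ((T ^^ n) x)"
proof (induction n arbitrary: P)
  case (Suc n)
  show ?case using AE_T[OF Suc.IH[OF Suc.prems]] by (simp add: funpow_swap1)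
qed simp

lemma AE_never_cross: "AE x in lborel. \<forall>n. (T ^^ n) x \<notin> cross"
proof -
  have "AE x in lborel. x \<notin> cross"
    using AE_not_vertical[of "1/2"] AE_not_horizontal[of "1/2"] by eventually_elim (auto simp: cross_def)
  then show ?thesis unfolding AE_all_countable by (intro allI AE_T_pow)
qed

end

subsection \<open>Itinerary domains and distortion\<close>

lemma supd_nonneg: "0 \<le> supd x y" unfolding supd_def by simp

context coupled_tents
begin

lemma T_unit_square: "x \<in> unit_square \<Longrightarrow> T x \<in> unit_square"
proof -
  assume "x \<in> unit_square"
  then have "fst x \<in> {0..1}" "snd x \<in> {0..1}" unfolding unit_square_def by auto
  then have F: "F (fst x) \<in> {0..1}" "F (snd x) \<in> {0..1}"
    unfolding F_def using range01 by blast+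
  have conv: "(1 - c) * u + c * w \<in> {0..1}" if "u \<in> {0..1}" "w \<in> {0..1}" for u w :: real
  proof -
    have "(1 - c) * u + c * w \<le> (1 - c) * 1 + c * 1" using that c_ge c_le by (intro add_mono mult_left_mono) auto
    moreover have "0 \<le> (1 - c) * u + c * w" using that c_ge c_le by (intro add_nonneg_nonneg mult_nonneg_nonneg) auto
    ultimately show ?thesis by simp
  qed
  have "(1 - c) * F (fst x) + c * F (snd x) \<in> {0..1}" "c * F (fst x) + (1 - c) * F (snd x) \<in> {0..1}"
    using conv[OF F] conv[OF F(2,1)] by (simp_all only: add.commute)
  then show ?thesis unfolding T_alt unit_square_def by (rule SigmaI)
qed

lemma T_pow_unit_square: "x \<in> unit_square \<Longrightarrow> (T ^^ n) x \<in> unit_square"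
  by (induction n) (auto simp: T_unit_square)

text \<open>Slopes are at least 1 in absolute value, so the Lipschitz bound on \<open>h'\<close> is
  also a relative one, and \<open>1 + t\<close> is at most \<open>exp t\<close>.\<close>

lemma dbranch_distortion: "\<bar>dbranch b x\<bar> \<le> \<bar>dbranch b y\<bar> * exp (\<bar>x - y\<bar> / 1000)"
proof -
  have 1: "1 \<le> \<bar>dbranch b y\<bar>" using h'_le[of y] s_ge unfolding dbranch_def by (auto simp: abs_le_iff)
  have "\<bar>dbranch b x\<bar> \<le> \<bar>dbranch b y\<bar> + \<bar>x - y\<bar> / 1000"
  proof -
    have "\<bar>dbranch b x - dbranch b y\<bar> \<le> \<bar>x - y\<bar> / 1000" using h'_lipschitz[of x y] unfolding dbranch_def by simp
    then show ?thesis by linarith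
  qed
  also have "\<dots> \<le> \<bar>dbranch b y\<bar> * (1 + \<bar>x - y\<bar> / 1000)"
    using mult_right_mono[OF 1, of "\<bar>x - y\<bar> / 1000"] by (simp add: algebra_simps)
  also have "\<dots> \<le> \<bar>dbranch b y\<bar> * exp (\<bar>x - y\<bar> / 1000)"
    by (intro mult_left_mono exp_ge_add_one_self) auto
  finally show ?thesis .
qed

lemma Jac_distortion: "Jac i x \<le> Jac i y * exp (supd x y / 500)"
proof -
  have "\<bar>dbranch (fst i) (fst x)\<bar> * \<bar>dbranch (snd i) (snd x)\<bar>
    \<le> (\<bar>dbranch (fst i) (fst y)\<bar> * exp (\<bar>fst x - fst y\<bar> / 1000)) * (\<bar>dbranch (snd i) (snd y)\<bar> * exp (\<bar>snd x - snd y\<bar> / 1000))"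
    by (intro mult_mono dbranch_distortion) auto
  also have "\<dots> = \<bar>dbranch (fst i) (fst y)\<bar> * \<bar>dbranch (snd i) (snd y)\<bar> * exp (\<bar>fst x - fst y\<bar> / 1000 + \<bar>snd x - snd y\<bar> / 1000)"
    by (simp add: exp_add)
  also have "\<dots> \<le> \<bar>dbranch (fst i) (fst y)\<bar> * \<bar>dbranch (snd i) (snd y)\<bar> * exp (supd x y / 500)"
  proof -
    have "\<bar>fst x - fst y\<bar> + \<bar>snd x - snd y\<bar> \<le> supd x y + supd x y" by (intro add_mono) (simp_all add: supd_def)
    then have "\<bar>fst x - fst y\<bar> / 1000 + \<bar>snd x - snd y\<bar> / 1000 \<le> supd x y / 500" by (simp add: field_simps)
    then show ?thesis by (intro mult_left_mono) auto
  qed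
  finally show ?thesis
    unfolding Jac_def using c_le by (simp add: mult.assoc mult_left_mono)
qed

end

text \<open>The box will be a cell that a given invariant set almost fills. Its size cannot be
  controlled, so the final estimates have to be uniform in it.\<close>

locale boxed_tents = coupled_tents +
  fixes a1 b1 a2 b2 :: real
  assumes box1: "0 \<le> a1" "a1 < b1" "b1 \<le> 1" and box2: "0 \<le> a2" "a2 < b2" "b2 \<le> 1"
begin

definition U :: "(real \<times> real) set" where "U = {a1<..<b1} \<times> {a2<..<b2}"

text \<open>Words list the most recent quadrant first: the head of \<open>w\<close> is visited at time \<open>length w - 1\<close>.\<close>

fun W :: "(bool \<times> bool) list \<Rightarrow> (real \<times> real) set" where
  "W [] = U"
| "W (i # w) = {x \<in> W w. (T ^^ length w) x \<in> quadrant i}"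

text \<open>This is the image of \<open>W w\<close>, as \<open>D_eq\<close> shows. Writing it with
  the globally injective branches makes openness a case of invariance of domain.\<close>

fun D :: "(bool \<times> bool) list \<Rightarrow> (real \<times> real) set" where
  "D [] = U"
| "D (i # w) = Tbr i ` (D w \<inter> quadrant i)"

fun JT :: "(bool \<times> bool) list \<Rightarrow> real \<times> real \<Rightarrow> real" where
  "JT [] x = 1"
| "JT (i # w) x = JT w x * Jac i ((T ^^ length w) x)"

lemma U_subset: "U \<subseteq> unit_square" using box1 box2 unfolding U_def unit_square_def by auto

lemma open_U: "open U" unfolding U_def by (intro open_Times) auto

definition area :: real where "area = (b1 - a1) * (b2 - a2)"

lemma area_pos: "0 < area" using box1 box2 by (simp add: area_def)

lemma emeasure_U: "emeasure lborel U = ennreal area" and emeasure_U_finite: "emeasure lborel U < \<infinity>"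
proof -
  show *: "emeasure lborel U = ennreal area"
    unfolding U_def area_def lborel_prod[symmetric] using box1 box2
    by (subst lborel.emeasure_pair_measure_Times) (auto simp: ennreal_mult)
  show "emeasure lborel U < \<infinity>" unfolding * by simp
qed

lemma continuous_Tbr: "continuous_on A (Tbr i)"
proof -
  have "continuous_on A (\<lambda>x. branch b (fst x))" "continuous_on A (\<lambda>x. branch b (snd x))" for A :: "(real \<times> real) set" and b
    by (auto intro!: continuous_on_compose2[OF continuous_branch[of UNIV]] continuous_intros)
  then show ?thesis unfolding Tbr_def by (auto intro!: continuous_intros)
qed

lemma open_D: "open (D w)"
proof (induction w)
  case (Cons i w)
  have "inj_on (Tbr i) (D w \<inter> quadrant i)" using Tbr_inj by (meson inj_onI)
  then show ?case
    unfolding D.simps by (intro invariance_of_domain continuous_Tbr open_Int open_quadrant Cons)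
qed (simp add: open_U)

lemma open_W: "open (W w)"
proof (induction w)
  case (Cons i w)
  have "W (i # w) = W w \<inter> (T ^^ length w) -` quadrant i" by auto
  then show ?case using Cons open_vimage[OF open_quadrant continuous_T_pow] by (simp add: open_Int)
qed (simp add: open_U)

lemma sets_W[measurable]: "W w \<in> sets borel" and sets_D[measurable]: "D w \<in> sets borel"
  and sets_U[measurable]: "U \<in> sets borel" and sets_quadrant[measurable]: "quadrant i \<in> sets borel"
  using open_W open_D open_U open_quadrant by auto

lemma W_subset: "W w \<subseteq> U" by (induction w) auto

lemma D_eq: "D w = (T ^^ length w) ` W w"
proof (induction w)
  case (Cons i w)
  have "D (i # w) = T ` ((T ^^ length w) ` W w \<inter> quadrant i)" 
    unfolding D.simps Cons by (rule image_cong, simp, metis IntD2 T_eq_Tbr)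
  then show ?case by auto
qed simp

lemma D_subset: "D w \<subseteq> unit_square"
  unfolding D_eq using W_subset U_subset T_pow_unit_square by blast

lemma measurable_JT[measurable]: "JT w \<in> borel_measurable borel"
proof (induction w)
  case (Cons i w)
  have [measurable]: "JT w \<in> borel_measurable borel" by fact
  have "JT (i # w) = (\<lambda>x. JT w x * Jac i ((T ^^ length w) x))" by auto
  then show ?case by simp
next
  case Nil
  have "JT [] = (\<lambda>x. 1)" by auto
  then show ?case by simp
qed

lemma JT_pos: "0 < JT w x" by (induction w) (auto intro!: mult_pos_pos Jac_pos)

text \<open>Change of variables for \<open>T ^^ length w\<close>, which is injective on
  \<open>W w\<close> with Jacobian \<open>JT w\<close>. The induction hypothesis is applied to an
  integrand that already carries the substitution for the latest step.\<close>

lemma nn_integral_W: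
  assumes [measurable]: "G \<in> borel_measurable borel"
  shows "(\<integral>\<^sup>+x\<in>W w. (G ((T ^^ length w) x) * ennreal (JT w x)) \<partial>lborel) = (\<integral>\<^sup>+y\<in>D w. G y \<partial>lborel)"
  using assms
proof (induction w arbitrary: G)
  case (Cons i w)
  have [measurable]: "G \<in> borel_measurable borel" by fact
  let ?G = "\<lambda>y. indicator (quadrant i) y * G (T y) * ennreal (Jac i y)"
  have "(\<integral>\<^sup>+x\<in>W (i # w). (G ((T ^^ length (i # w)) x) * ennreal (JT (i # w) x)) \<partial>lborel)
    = (\<integral>\<^sup>+x\<in>W w. (?G ((T ^^ length w) x) * ennreal (JT w x)) \<partial>lborel)"
    using JT_pos Jac_pos
    by (auto intro!: nn_integral_cong simp: indicator_def ennreal_mult less_imp_le mult_ac)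
  also have "\<dots> = (\<integral>\<^sup>+y\<in>D w. ?G y \<partial>lborel)" by (rule Cons.IH) measurable
  also have "\<dots> = (\<integral>\<^sup>+y. (G (Tbr i y) * indicator (D (i # w)) (Tbr i y)) * ennreal (Jac i y) \<partial>lborel)"
  proof (rule nn_integral_cong)
    fix y
    have "Tbr i y \<in> D (i # w) \<longleftrightarrow> y \<in> D w \<and> y \<in> quadrant i"
      unfolding D.simps image_iff using Tbr_inj by blast
    then show "?G y * indicator (D w) y = (G (Tbr i y) * indicator (D (i # w)) (Tbr i y)) * ennreal (Jac i y)"
      using T_eq_Tbr[of y i] by (auto simp: indicator_def simp del: D.simps)
  qed
  also have "\<dots> = (\<integral>\<^sup>+y\<in>D (i # w). G y \<partial>lborel)"
    by (rule nn_integral_Tbr) (measurable, auto simp: open_D simp del: D.simps)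
  finally show ?case .
qed simp

text \<open>Expansion absorbs the new distortion at every step: for a previous distance d, d/100 +
  d/500 = 12 d/1000, which is below (19/10) d/100. Hence the constant does not depend on the length
  of the word.\<close>

lemma JT_distortion:
  assumes "x \<in> W w" "y \<in> W w"
  shows "JT w x \<le> JT w y * exp (supd ((T ^^ length w) x) ((T ^^ length w) y) / 100)"
  using assms
proof (induction w)
  case (Cons i w)
  let ?x = "(T ^^ length w) x" and ?y = "(T ^^ length w) y"
  have q: "?x \<in> quadrant i" "?y \<in> quadrant i" using Cons.prems by auto
  have "JT (i # w) x \<le> (JT w y * exp (supd ?x ?y / 100)) * (Jac i ?y * exp (supd ?x ?y / 500))"
    unfolding JT.simps using Cons
    by (intro mult_mono Jac_distortion mult_nonneg_nonneg less_imp_le[OF Jac_pos] less_imp_le[OF JT_pos]) simp_all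
  also have "\<dots> = JT (i # w) y * exp (supd ?x ?y * (12/1000))"
    by (simp add: mult_exp_exp algebra_simps)
  also have "\<dots> \<le> JT (i # w) y * exp (supd (Tbr i ?x) (Tbr i ?y) / 100)"
    using Tbr_expand[of ?x ?y i] JT_pos[of "i # w" y] supd_nonneg[of ?x ?y] by (intro mult_left_mono) (auto simp del: JT.simps)
  finally show ?case using T_eq_Tbr[OF q(1)] T_eq_Tbr[OF q(2)] by simp
qed (simp add: supd_nonneg)

text \<open>Images lie in the unit square, so \<open>JT w\<close> varies on \<open>W w\<close> by a
  factor of at most \<open>exp (1/100)\<close>. Passing to the image and back uses this twice, and
  \<open>exp (1/50)\<close> is below 1.05. Estimates on \<open>D w\<close> thus return to
  \<open>W w\<close> with a loss independent of \<open>w\<close>.\<close>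

lemma transfer:
  assumes [measurable]: "G1 \<in> borel_measurable borel" "G2 \<in> borel_measurable borel"
    and le: "(\<integral>\<^sup>+y\<in>D w. G1 y \<partial>lborel) \<le> (\<integral>\<^sup>+y\<in>D w. G2 y \<partial>lborel)"
  shows "(\<integral>\<^sup>+x\<in>W w. G1 ((T ^^ length w) x) \<partial>lborel) \<le> ennreal (105/100) * (\<integral>\<^sup>+x\<in>W w. G2 ((T ^^ length w) x) \<partial>lborel)"
proof (cases "W w = {}")
  case False
  then obtain z where z: "z \<in> W w" by auto
  let ?J = "JT w z" and ?e = "exp (1/100 :: real)"
  have J: "0 < ?J" by (rule JT_pos)
  have cmp: "JT w x \<le> JT w y * ?e" if "x \<in> W w" "y \<in> W w" for x y
  proof -
    have "(T ^^ length w) x \<in> unit_square" "(T ^^ length w) y \<in> unit_square"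
      using that W_subset U_subset T_pow_unit_square by blast+
    then have "supd ((T ^^ length w) x) ((T ^^ length w) y) \<le> 1"
      unfolding supd_def unit_square_def by auto
    then have "JT w y * exp (supd ((T ^^ length w) x) ((T ^^ length w) y) / 100) \<le> JT w y * ?e"
      using JT_pos[of w y] by (intro mult_left_mono) auto
    then show ?thesis using JT_distortion[OF that] by linarith
  qed
  have "(\<integral>\<^sup>+x\<in>W w. G1 ((T ^^ length w) x) \<partial>lborel) \<le> (\<integral>\<^sup>+x. ennreal (?e / ?J) * (G1 ((T ^^ length w) x) * ennreal (JT w x) * indicator (W w) x) \<partial>lborel)"
  proof (rule nn_integral_mono)
    fix x
    show "G1 ((T ^^ length w) x) * indicator (W w) x \<le> ennreal (?e / ?J) * (G1 ((T ^^ length w) x) * ennreal (JT w x) * indicator (W w) x)"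
    proof (cases "x \<in> W w")
      case True
      have "1 \<le> ?e / ?J * JT w x" using cmp[OF z True] J by (simp add: field_simps)
      then have "ennreal 1 \<le> ennreal (?e / ?J) * ennreal (JT w x)"
        using J JT_pos[of w x] by (subst ennreal_mult[symmetric]) (auto intro!: ennreal_leI)
      then have "1 * G1 ((T ^^ length w) x) \<le> (ennreal (?e / ?J) * ennreal (JT w x)) * G1 ((T ^^ length w) x)"
        by (intro mult_right_mono) auto
      then show ?thesis using True by (simp add: mult_ac)
    qed simp
  qed
  also have "\<dots> = ennreal (?e / ?J) * (\<integral>\<^sup>+y\<in>D w. G1 y \<partial>lborel)"
    by (subst nn_integral_cmult) (simp_all add: nn_integral_W)
  also have "\<dots> \<le> ennreal (?e / ?J) * (\<integral>\<^sup>+y\<in>D w. G2 y \<partial>lborel)" using le by (rule mult_left_mono) simp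
  also have "\<dots> = ennreal (?e / ?J) * (\<integral>\<^sup>+x\<in>W w. (G2 ((T ^^ length w) x) * ennreal (JT w x)) \<partial>lborel)"
    by (simp add: nn_integral_W)
  also have "\<dots> = (\<integral>\<^sup>+x. ennreal (?e / ?J) * (G2 ((T ^^ length w) x) * ennreal (JT w x) * indicator (W w) x) \<partial>lborel)"
    by (rule nn_integral_cmult[symmetric]) measurable
  also have "\<dots> \<le> (\<integral>\<^sup>+x. ennreal (?e * ?e) * (G2 ((T ^^ length w) x) * indicator (W w) x) \<partial>lborel)"
  proof (rule nn_integral_mono)
    fix x
    show "ennreal (?e / ?J) * (G2 ((T ^^ length w) x) * ennreal (JT w x) * indicator (W w) x) \<le> ennreal (?e * ?e) * (G2 ((T ^^ length w) x) * indicator (W w) x)"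
    proof (cases "x \<in> W w")
      case True
      have "?e / ?J * JT w x \<le> ?e * ?e" using cmp[OF True z] J by (simp add: field_simps)
      then have "ennreal (?e / ?J) * ennreal (JT w x) \<le> ennreal (?e * ?e)"
        using J JT_pos[of w x] by (subst ennreal_mult[symmetric]) (auto intro!: ennreal_leI)
      then have "(ennreal (?e / ?J) * ennreal (JT w x)) * G2 ((T ^^ length w) x) \<le> ennreal (?e * ?e) * G2 ((T ^^ length w) x)"
        by (intro mult_right_mono) auto
      then show ?thesis using True by (simp add: mult_ac)
    qed simp
  qed
  also have "\<dots> = ennreal (?e * ?e) * (\<integral>\<^sup>+x\<in>W w. G2 ((T ^^ length w) x) \<partial>lborel)"
    by (rule nn_integral_cmult) measurable
  also have "\<dots> \<le> ennreal (105/100) * (\<integral>\<^sup>+x\<in>W w. G2 ((T ^^ length w) x) \<partial>lborel)"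
  proof -
    have "?e * ?e = exp (1/50)" by (simp add: mult_exp_exp)
    also have "\<dots> \<le> 1 + 1/50 + (1/50)\<^sup>2" by (rule exp_bound) auto
    also have "\<dots> \<le> (105/100 :: real)" by (simp add: power2_eq_square)
    finally show ?thesis by (intro mult_right_mono ennreal_leI) auto
  qed
  finally show ?thesis .
qed simp

text \<open>Almost every orbit avoids \<open>cross\<close> at all times, so exactly one quadrant
  prolongs each word: the sets \<open>W w\<close> with \<open>length w = n\<close> partition
  \<open>U\<close> up to a null set.\<close>

lemma nn_integral_U_words:
  assumes [measurable]: "\<Phi> \<in> borel_measurable borel"
  shows "(\<integral>\<^sup>+x\<in>U. \<Phi> x \<partial>lborel) = (\<Sum>w | length w = n. \<integral>\<^sup>+x\<in>W w. \<Phi> x \<partial>lborel)"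
proof (induction n)
  case (Suc n)
  have step: "(\<integral>\<^sup>+x\<in>W w. \<Phi> x \<partial>lborel) = (\<Sum>i\<in>UNIV. \<integral>\<^sup>+x\<in>W (i # w). \<Phi> x \<partial>lborel)" for w
  proof -
    have "(\<integral>\<^sup>+x\<in>W w. \<Phi> x \<partial>lborel) = (\<integral>\<^sup>+x. (\<Sum>i\<in>UNIV. \<Phi> x * indicator (W (i # w)) x) \<partial>lborel)"
    proof (rule nn_integral_cong_AE, use AE_never_cross in eventually_elim)
      case (elim x)
      let ?y = "(T ^^ length w) x"
      have eq: "\<Phi> x * indicator (W (i # w)) x = (if i = (fst ?y < 1/2, snd ?y < 1/2) then \<Phi> x * indicator (W w) x else 0)" for i
        using elim by (simp add: indicator_def mem_quadrant_iff)
      show ?case unfolding eq by (subst sum.delta) auto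
    qed
    also have "\<dots> = (\<Sum>i\<in>UNIV. \<integral>\<^sup>+x\<in>W (i # w). \<Phi> x \<partial>lborel)"
      by (rule nn_integral_sum) (measurable, auto simp: open_W simp del: W.simps)
    finally show ?thesis .
  qed
  have inj: "inj_on (\<lambda>(w, i). i # w) A" for A :: "((bool \<times> bool) list \<times> (bool \<times> bool)) set" by (auto simp: inj_on_def)
  have im: "{w. length w = Suc n} = (\<lambda>(w, i). i # w) ` ({w. length w = n} \<times> (UNIV :: (bool \<times> bool) set))"
  proof (intro equalityI subsetI)
    fix w :: "(bool \<times> bool) list" assume "w \<in> {w. length w = Suc n}"
    then obtain i v where "w = i # v" "length v = n" by (cases w) auto
    then show "w \<in> (\<lambda>(w, i). i # w) ` ({w. length w = n} \<times> UNIV)"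
      by (intro image_eqI[of _ _ "(v, i)"]) simp_all
  qed auto
  have "(\<integral>\<^sup>+x\<in>U. \<Phi> x \<partial>lborel) = (\<Sum>w | length w = n. \<Sum>i\<in>UNIV. \<integral>\<^sup>+x\<in>W (i # w). \<Phi> x \<partial>lborel)"
    unfolding Suc by (intro sum.cong refl step)
  also have "\<dots> = (\<Sum>w | length w = Suc n. \<integral>\<^sup>+x\<in>W w. \<Phi> x \<partial>lborel)"
    unfolding im sum.cartesian_product by (subst sum.reindex[OF inj]) (simp_all only: comp_def case_prod_unfold)
  finally show ?case .
qed simp

text \<open>The cap confines the cutting cost to a window about the line. Outside it the penalty is
  the constant 4 = 256 powr (1/4), and the window is narrow enough for
  \<open>no_return\<close>.\<close>

definition cutd :: "real \<Rightarrow> real" where "cutd y = min \<bar>y - 1/2\<bar> (1/256)"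

text \<open>A sup-norm ball smaller than the distances to both lines stays within one quadrant, and
  the branch there enlarges its inner radius by at least 19/10. The value is positive on
  \<open>U\<close> for orbits that avoid \<open>cross\<close>.\<close>

fun rad :: "nat \<Rightarrow> real \<times> real \<Rightarrow> real" where
  "rad 0 x = min (min (fst x - a1) (b1 - fst x)) (min (snd x - a2) (b2 - snd x))"
| "rad (Suc n) x = 19/10 * min (rad n x) (min (cutd (fst ((T ^^ n) x))) (cutd (snd ((T ^^ n) x))))"

lemma measurable_cutd[measurable]: "cutd \<in> borel_measurable borel" unfolding cutd_def by measurable

lemma measurable_rad[measurable]: "rad n \<in> borel_measurable borel"
proof (induction n)
  case 0
  have "rad 0 = (\<lambda>x. min (min (fst x - a1) (b1 - fst x)) (min (snd x - a2) (b2 - snd x)))" by auto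
  then show ?case unfolding borel_prod[symmetric] by simp
next
  case (Suc n)
  have [measurable]: "rad n \<in> borel_measurable borel" by fact
  have [measurable]: "(\<lambda>x::real\<times>real. fst x) \<in> borel_measurable borel" "(\<lambda>x::real\<times>real. snd x) \<in> borel_measurable borel"
    unfolding borel_prod[symmetric] by measurable
  have "rad (Suc n) = (\<lambda>x. 19/10 * min (rad n x) (min (cutd (fst ((T ^^ n) x))) (cutd (snd ((T ^^ n) x)))))" by auto
  then show ?case by simp
qed

lemma rad_pos: "x \<in> U \<Longrightarrow> (\<And>n. (T ^^ n) x \<notin> cross) \<Longrightarrow> 0 < rad n x"
  by (induction n) (auto simp: U_def cutd_def cross_def)

text \<open>The point \<open>y\<close> is pulled back by the global branch to some \<open>z\<close>.
  Expansion puts \<open>z\<close> closer to the orbit than the previous radius and than both lines,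
  so \<open>z\<close> lies in \<open>D w\<close> and in the same quadrant.\<close>

lemma rad_ball: "x \<in> W w \<Longrightarrow> supd y ((T ^^ length w) x) < rad (length w) x \<Longrightarrow> y \<in> D w"
proof (induction w arbitrary: y)
  case Nil
  then have "\<bar>fst y - fst x\<bar> < min (fst x - a1) (b1 - fst x)" "\<bar>snd y - snd x\<bar> < min (snd x - a2) (b2 - snd x)"
    by (simp_all add: supd_def)
  then have "fst y \<in> {a1<..<b1}" "snd y \<in> {a2<..<b2}" by (simp_all add: abs_less_iff)
  then show ?case unfolding D.simps U_def by (simp add: mem_Times_iff)
next
  case (Cons i w)
  let ?x = "(T ^^ length w) x"
  have q: "?x \<in> quadrant i" using Cons.prems by auto
  obtain z where z: "Tbr i z = y" using Tbr_surj by blast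
  have "19/10 * supd z ?x \<le> supd y (T ?x)" using Tbr_expand[of z ?x i] z T_eq_Tbr[OF q] by simp
  also have "\<dots> < 19/10 * min (rad (length w) x) (min (cutd (fst ?x)) (cutd (snd ?x)))" using Cons.prems(2) by simp
  finally have lt: "supd z ?x < min (rad (length w) x) (min (cutd (fst ?x)) (cutd (snd ?x)))"
    by (subst (asm) mult_less_cancel_left_pos) simp_all
  then have "z \<in> D w" using Cons by simp
  moreover have "\<bar>fst z - fst ?x\<bar> < \<bar>fst ?x - 1/2\<bar>" "\<bar>snd z - snd ?x\<bar> < \<bar>snd ?x - 1/2\<bar>"
  proof -
    have "\<bar>fst z - fst ?x\<bar> \<le> supd z ?x" "\<bar>snd z - snd ?x\<bar> \<le> supd z ?x" by (simp_all add: supd_def)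
    moreover have "supd z ?x < cutd (fst ?x)" "supd z ?x < cutd (snd ?x)" using lt by simp_all
    moreover have "cutd t \<le> \<bar>t - 1/2\<bar>" for t by (simp add: cutd_def)
    ultimately show "\<bar>fst z - fst ?x\<bar> < \<bar>fst ?x - 1/2\<bar>" "\<bar>snd z - snd ?x\<bar> < \<bar>snd ?x - 1/2\<bar>"
      by (meson le_less_trans less_le_trans)+
  qed
  then have "(fst z < 1/2 \<longleftrightarrow> fst ?x < 1/2) \<and> (1/2 < fst z \<longleftrightarrow> 1/2 < fst ?x)"
    "(snd z < 1/2 \<longleftrightarrow> snd ?x < 1/2) \<and> (1/2 < snd z \<longleftrightarrow> 1/2 < snd ?x)" by linarith+
  then have "z \<in> quadrant i" using q unfolding quadrant_def by (cases "fst i"; cases "snd i"; simp)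
  ultimately have "Tbr i z \<in> D (i # w)" unfolding D.simps by (intro imageI IntI)
  then show ?case unfolding z .
qed

end

subsection \<open>Energy of the distance to the singular lines\<close>

definition coord :: "bool \<Rightarrow> real \<times> real \<Rightarrow> real" where "coord b = (if b then fst else snd)"

lemma measurable_coord[measurable]: "coord b \<in> borel_measurable borel"
  unfolding coord_def borel_prod[symmetric] by (cases b) simp_all

lemma supd_le_dist: "supd x y \<le> dist x y"
  unfolding supd_def using dist_fst_le[of x y] dist_snd_le[of x y] by (simp add: dist_real_def)

lemma powr_256: "(1/256 :: real) powr (-1/4) = 4"
proof -
  have "(1/256 :: real) = 4 powr (-4)" by (simp add: powr_minus_divide)
  then show ?thesis by (simp only: powr_powr) simp
qed

lemma ennreal_le_add_diff: "a \<le> b + (a - b)" for a b :: ennreal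
  by (cases "b \<le> a") (simp_all add: add_diff_inverse_ennreal add_increasing2)

text \<open>Fubini over the lines parallel to coordinate \<open>b\<close>. On such a line the planar
  distance to \<open>- R\<close> is at most the distance within the line, as
  \<open>slice_cut\<close> demands. \<open>R \<noteq> UNIV\<close> keeps \<open>infdist\<close>
  positive on \<open>R\<close>, since the distance to the empty set is 0 by convention. The constant
  16/3 is 4/3 times \<open>(1/256) powr (-1/4)\<close>.\<close>

lemma cut_cost:
  fixes R :: "(real \<times> real) set" and b :: bool
  assumes R: "open R" "R \<noteq> UNIV"
  defines "S \<equiv> R \<inter> {y. \<bar>coord b y - 1/2\<bar> < 1/256}"
  shows "(\<integral>\<^sup>+y\<in>S. (ennreal (\<bar>coord b y - 1/2\<bar> powr (-1/4)) - ennreal (infdist y (- R) powr (-1/4))) \<partial>lborel)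
    \<le> (\<integral>\<^sup>+y\<in>S. (ennreal 0.19 * ennreal (infdist y (- R) powr (-1/4)) + ennreal (16/3)) \<partial>lborel)"
  (is "(\<integral>\<^sup>+y\<in>_. ?f y \<partial>lborel) \<le> (\<integral>\<^sup>+y\<in>_. ?g y \<partial>lborel)")
proof -
  have [measurable]: "R \<in> sets borel" using R by simp
  have [measurable]: "S \<in> sets borel" unfolding S_def by measurable
  have [measurable]: "(\<lambda>y. infdist y (- R)) \<in> borel_measurable borel"
    by (intro borel_measurable_continuous_onI continuous_on_infdist continuous_on_id)
  have mf: "(\<lambda>y. ?f y * indicator S y) \<in> borel_measurable borel" by measurable
  have mg: "(\<lambda>y. ?g y * indicator S y) \<in> borel_measurable borel" by measurable
  have slice: "(\<integral>\<^sup>+t. ?f (e t) * indicator S (e t) \<partial>lborel) \<le> (\<integral>\<^sup>+t. ?g (e t) * indicator S (e t) \<partial>lborel)"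
    if e: "continuous_on UNIV e" "\<And>t. coord b (e t) = t" "\<And>t u. dist (e t) (e u) = \<bar>t - u\<bar>" for e :: "real \<Rightarrow> real \<times> real"
  proof -
    let ?Q = "e -` R"
    have Q: "open ?Q" by (rule open_vimage[OF R(1) e(1)])
    have [measurable]: "e \<in> borel_measurable borel" using e(1) by (rule borel_measurable_continuous_onI)
    have m: "(\<lambda>t. infdist (e t) (- R)) \<in> borel_measurable borel" by measurable
    have pos: "0 < infdist (e t) (- R)" if "t \<in> ?Q" for t
      using that R infdist_pos_not_in_closed[of "- R" "e t"] by (auto simp: closed_Compl)
    have le: "infdist (e t) (- R) \<le> \<bar>t - u\<bar>" if "t \<in> ?Q" "u \<notin> ?Q" for t u
      using that infdist_le[of "e u" "- R" "e t"] e(3)[of t u] by simp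
    have ind: "indicator S (e t) = (indicator (?Q \<inter> {1/2-1/256<..<1/2+1/256}) t :: ennreal)" for t
    proof -
      have "\<bar>t - 1/2\<bar> < 1/256 \<longleftrightarrow> 1/2-1/256 < t \<and> t < 1/2+1/256" by linarith
      then show ?thesis by (simp add: indicator_def S_def e(2))
    qed
    have "4/3 * (1/256) powr (-1/4) = (16/3 :: real)" unfolding powr_256 by simp
    then show ?thesis
      using slice_cut[OF Q m pos le, of "1/256" "1/2"] unfolding ind e(2) by simp
  qed
  show ?thesis
  proof (cases b)
    case True
    show ?thesis
      unfolding nn_integral_lborel_pair(2)[OF mf] nn_integral_lborel_pair(2)[OF mg]
      by (rule nn_integral_mono, rule slice) (auto intro!: continuous_intros simp: coord_def True dist_prod_def dist_real_def)
  next
    case False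
    show ?thesis
      unfolding nn_integral_lborel_pair(1)[OF mf] nn_integral_lborel_pair(1)[OF mg]
      by (rule nn_integral_mono, rule slice) (auto intro!: continuous_intros simp: coord_def False dist_prod_def dist_real_def)
  qed
qed

context coupled_tents
begin

lemma coord_T: "y \<in> unit_square \<Longrightarrow> \<bar>coord b (T y) - F (coord b y)\<bar> \<le> c"
proof -
  assume "y \<in> unit_square"
  then have "fst y \<in> {0..1}" "snd y \<in> {0..1}" unfolding unit_square_def by auto
  then have "F (fst y) \<in> {0..1}" "F (snd y) \<in> {0..1}" unfolding F_def using range01 by blast+
  then have "\<bar>F (fst y) - F (snd y)\<bar> \<le> 1" "\<bar>F (snd y) - F (fst y)\<bar> \<le> 1" by (auto simp: abs_le_iff)
  then have "\<bar>c * (F (fst y) - F (snd y))\<bar> \<le> c" "\<bar>c * (F (snd y) - F (fst y))\<bar> \<le> c"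
    using c_ge by (simp_all add: abs_mult mult_left_le)
  then show ?thesis by (cases b) (simp_all add: coord_def T_alt algebra_simps)
qed

text \<open>The coordinate is at least 0.99 after one step, at most 0.0225 after two and at most
  0.0475 after three. Each step allows 1/1000 for the coupling and 1/1000 for
  \<open>h\<close>.\<close>

lemma no_return:
  assumes y: "y \<in> unit_square" and near: "\<bar>coord b y - 1/2\<bar> < 1/256" and j: "0 < j" "j < 4"
  shows "\<not> \<bar>coord b ((T ^^ j) y) - 1/2\<bar> < 1/256"
proof -
  define z where "z j = coord b ((T ^^ j) y)" for j
  have z01: "z j \<in> {0..1}" for j
    using T_pow_unit_square[OF y, of j] by (auto simp: z_def coord_def unit_square_def)
  have step: "\<bar>z (Suc j) - F (z j)\<bar> \<le> 1/1000" for j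
    using coord_T[OF T_pow_unit_square[OF y, of j], of b] c_le by (simp add: z_def)
  have F: "\<bar>F t - (1 - s * \<bar>t - 1/2\<bar>)\<bar> \<le> 1/1000" if "t \<in> {0..1}" for t
    using h_le[OF that] by (simp add: F_def tent_def)
  have "s * \<bar>z 0 - 1/2\<bar> \<le> 2 * (1/256)" using near s_ge s_le by (intro mult_mono) (auto simp: z_def)
  then have z1: "99/100 \<le> z 1" using step[of 0] F[OF z01[of 0]] unfolding One_nat_def by linarith
  have "1999/1000 * (49/100) \<le> s * \<bar>z 1 - 1/2\<bar>" using z1 s_ge by (intro mult_mono) auto
  then have z2: "z 2 \<le> 225/10000" using step[of 1] F[OF z01[of 1]] unfolding numeral_2_eq_2 One_nat_def by linarith
  have "1999/1000 * (4775/10000) \<le> s * \<bar>z 2 - 1/2\<bar>" using z2 s_ge by (intro mult_mono) auto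
  then have z3: "z 3 \<le> 475/10000" using step[of 2] F[OF z01[of 2]] unfolding numeral_2_eq_2 numeral_3_eq_3 by linarith
  have "j = 1 \<or> j = 2 \<or> j = 3" using j by linarith
  then show ?thesis using z1 z2 z3 unfolding z_def[symmetric] by auto
qed

end

context boxed_tents
begin

text \<open>\<open>0 powr (-1/4)\<close> is 0 rather than infinite, so comparisons of penalties
  require positive radii; \<open>AE_good\<close> provides them almost everywhere.\<close>

definition penalty :: "nat \<Rightarrow> real \<times> real \<Rightarrow> ennreal" where "penalty n x = ennreal (rad n x powr (-1/4))"
definition line_penalty :: "bool \<Rightarrow> nat \<Rightarrow> real \<times> real \<Rightarrow> ennreal" where
  "line_penalty b n x = ennreal (\<bar>coord b ((T ^^ n) x) - 1/2\<bar> powr (-1/4))"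
definition near :: "bool \<Rightarrow> nat \<Rightarrow> (real \<times> real) set" where
  "near b n = {x. \<bar>coord b ((T ^^ n) x) - 1/2\<bar> < 1/256}"
definition energy :: "nat \<Rightarrow> ennreal" where "energy n = (\<integral>\<^sup>+x\<in>U. penalty n x \<partial>lborel)"

lemma measurable_penalty[measurable]: "penalty n \<in> borel_measurable borel" unfolding penalty_def by measurable
lemma measurable_line_penalty[measurable]: "line_penalty b n \<in> borel_measurable borel" unfolding line_penalty_def by measurable
lemma sets_near[measurable]: "near b n \<in> sets borel" unfolding near_def by measurable

lemma AE_good: "AE x in lborel. x \<in> U \<longrightarrow> (\<forall>n. 0 < rad n x)"
  using AE_never_cross by eventually_elim (auto intro: rad_pos)

lemma D_not_UNIV: "D w \<noteq> UNIV"
proof -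
  have "(2, 2) \<notin> D w" using D_subset[of w] by (auto simp: unit_square_def)
  then show ?thesis by blast
qed

text \<open>Connects the recursive sup-norm radius with the Euclidean distance in
  \<open>cut_cost\<close>: a Euclidean ball lies in the sup-norm ball of the same radius.\<close>

lemma rad_le_infdist:
  assumes "x \<in> W w" shows "rad (length w) x \<le> infdist ((T ^^ length w) x) (- D w)"
proof -
  have ne: "- D w \<noteq> {}" using D_not_UNIV[of w] by auto
  have "rad (length w) x \<le> dist ((T ^^ length w) x) y" if "y \<in> - D w" for y
    using rad_ball[OF assms, of y] that supd_le_dist[of y "(T ^^ length w) x"] by (force simp: dist_commute)
  then show ?thesis unfolding infdist_notempty[OF ne] using ne by (intro cINF_greatest) auto
qed

text \<open>\<open>cut_cost\<close> is applied to every image \<open>D w\<close> and brought back by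
  \<open>transfer\<close>. The distortion factor 1.05 turns 0.19 into 0.1995 and 16/3 into 5.6,
  rounded up to 0.2 and 6.\<close>

lemma cut_cost_U:
  "(\<integral>\<^sup>+x\<in>U. ((line_penalty b n x - penalty n x) * indicator (near b n) x) \<partial>lborel)
    \<le> ennreal 0.2 * (\<integral>\<^sup>+x\<in>U. (penalty n x * indicator (near b n) x) \<partial>lborel) + ennreal 6 * emeasure lborel U"
proof -
  define N where "N = {y::real\<times>real. \<bar>coord b y - 1/2\<bar> < 1/256}"
  have [measurable]: "N \<in> sets borel" unfolding N_def by measurable
  have word: "(\<integral>\<^sup>+x\<in>W w. ((line_penalty b n x - penalty n x) * indicator (near b n) x) \<partial>lborel)
    \<le> (\<integral>\<^sup>+x\<in>W w. (ennreal 0.2 * (penalty n x * indicator (near b n) x) + ennreal 6) \<partial>lborel)"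
    if n: "length w = n" for w
  proof -
    let ?\<delta> = "\<lambda>y. infdist y (- D w)"
    have [measurable]: "?\<delta> \<in> borel_measurable borel"
      by (intro borel_measurable_continuous_onI continuous_on_infdist continuous_on_id)
    let ?G1 = "\<lambda>y. (ennreal (\<bar>coord b y - 1/2\<bar> powr (-1/4)) - ennreal (?\<delta> y powr (-1/4))) * indicator N y"
    let ?G2 = "\<lambda>y. (ennreal 0.19 * ennreal (?\<delta> y powr (-1/4)) + ennreal (16/3)) * indicator N y"
    have "(\<integral>\<^sup>+y\<in>D w. ?G1 y \<partial>lborel) \<le> (\<integral>\<^sup>+y\<in>D w. ?G2 y \<partial>lborel)"
      using cut_cost[where R="D w" and b=b, OF open_D D_not_UNIV]
      unfolding N_def[symmetric] indicator_inter_arith by (simp add: mult_ac)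
    then have tr: "(\<integral>\<^sup>+x\<in>W w. ?G1 ((T ^^ length w) x) \<partial>lborel) \<le> ennreal (105/100) * (\<integral>\<^sup>+x\<in>W w. ?G2 ((T ^^ length w) x) \<partial>lborel)"
      by (intro transfer) measurable
    \<comment> \<open>This inequality helps on both sides: subtracting the larger
      \<open>penalty\<close> leaves less on the left, and replacing the distance term by it gives
      more on the right.\<close>
    have good: "AE x in lborel. x \<in> W w \<longrightarrow> ennreal (?\<delta> ((T ^^ n) x) powr (-1/4)) \<le> penalty n x"
      using AE_good
    proof eventually_elim
      case (elim x)
      show ?case
      proof
        assume x: "x \<in> W w"
        then have "0 < rad n x" using elim W_subset by blast
        then show "ennreal (?\<delta> ((T ^^ n) x) powr (-1/4)) \<le> penalty n x"
          using rad_le_infdist[OF x] n unfolding penalty_def by (intro ennreal_leI powr_mono2') auto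
      qed
    qed
    have ind: "indicator N ((T ^^ n) x) = (indicator (near b n) x :: ennreal)" for x
      by (simp add: indicator_def near_def N_def)
    have "(\<integral>\<^sup>+x\<in>W w. ((line_penalty b n x - penalty n x) * indicator (near b n) x) \<partial>lborel) \<le> (\<integral>\<^sup>+x\<in>W w. ?G1 ((T ^^ length w) x) \<partial>lborel)"
    proof (rule nn_integral_mono_AE, use good in eventually_elim)
      case (elim x)
      then show ?case
        by (cases "x \<in> W w"; cases "x \<in> near b n") (simp_all add: n ind line_penalty_def ennreal_minus_mono)
    qed
    also note tr
    also have "ennreal (105/100) * (\<integral>\<^sup>+x\<in>W w. ?G2 ((T ^^ length w) x) \<partial>lborel)
       = (\<integral>\<^sup>+x. ennreal (105/100) * (?G2 ((T ^^ length w) x) * indicator (W w) x) \<partial>lborel)"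
      by (rule nn_integral_cmult[symmetric]) measurable
    also have "\<dots> \<le> (\<integral>\<^sup>+x\<in>W w. (ennreal 0.2 * (penalty n x * indicator (near b n) x) + ennreal 6) \<partial>lborel)"
    proof (rule nn_integral_mono_AE, use good in eventually_elim)
      case (elim x)
      let ?d = "ennreal (?\<delta> ((T ^^ n) x) powr (-1/4))"
      have "ennreal (105/100) * (ennreal 0.19 * ?d + ennreal (16/3)) = ennreal (105/100 * 0.19) * ?d + ennreal (105/100 * (16/3))"
        by (simp add: distrib_left mult.assoc[symmetric] ennreal_mult[symmetric])
      also have "\<dots> \<le> ennreal 0.2 * ?d + ennreal 6" by (intro add_mono mult_right_mono ennreal_leI) auto
      finally have *: "ennreal (105/100) * (ennreal 0.19 * ?d + ennreal (16/3)) \<le> ennreal 0.2 * ?d + ennreal 6" .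
      show ?case
      proof (cases "x \<in> W w \<and> x \<in> near b n")
        case True
        then have "?d \<le> penalty n x" using elim by simp
        then have "ennreal 0.2 * ?d + ennreal 6 \<le> ennreal 0.2 * penalty n x + ennreal 6" by (intro add_mono mult_left_mono) auto
        with * have "ennreal (105/100) * (ennreal 0.19 * ?d + ennreal (16/3)) \<le> ennreal 0.2 * penalty n x + ennreal 6" by (rule order_trans)
        then show ?thesis using True by (simp add: n ind)
      next
        case False
        then show ?thesis by (cases "x \<in> W w") (simp_all add: n ind)
      qed
    qed
    finally show ?thesis .
  qed
  have "(\<integral>\<^sup>+x\<in>U. ((line_penalty b n x - penalty n x) * indicator (near b n) x) \<partial>lborel)
    = (\<Sum>w | length w = n. \<integral>\<^sup>+x\<in>W w. ((line_penalty b n x - penalty n x) * indicator (near b n) x) \<partial>lborel)"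
    by (rule nn_integral_U_words) measurable
  also have "\<dots> \<le> (\<Sum>w | length w = n. \<integral>\<^sup>+x\<in>W w. (ennreal 0.2 * (penalty n x * indicator (near b n) x) + ennreal 6) \<partial>lborel)"
    by (intro sum_mono word) simp
  also have "\<dots> = (\<integral>\<^sup>+x\<in>U. (ennreal 0.2 * (penalty n x * indicator (near b n) x) + ennreal 6) \<partial>lborel)"
    by (rule nn_integral_U_words[symmetric]) measurable
  also have "\<dots> = (\<integral>\<^sup>+x. ennreal 0.2 * (penalty n x * indicator (near b n) x * indicator U x) + ennreal 6 * indicator U x \<partial>lborel)"
    by (simp add: distrib_right mult.assoc)
  also have "\<dots> = ennreal 0.2 * (\<integral>\<^sup>+x\<in>U. (penalty n x * indicator (near b n) x) \<partial>lborel) + ennreal 6 * emeasure lborel U"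
    by (simp add: nn_integral_add nn_integral_cmult)
  finally show ?thesis .
qed

definition \<kappa> :: real where "\<kappa> = (19/10) powr (-1/4)"

text \<open>The power is decreasing, so a minimum of radii becomes a maximum of penalties. That
  maximum is bounded by the old penalty, the positive excess of each line inside its window, and the
  capped value 4.\<close>

lemma penalty_Suc_le:
  assumes "0 < rad (Suc n) x"
  shows "penalty (Suc n) x \<le> ennreal \<kappa> * (penalty n x + (line_penalty True n x - penalty n x) * indicator (near True n) x
    + (line_penalty False n x - penalty n x) * indicator (near False n) x + ennreal 4)"
proof -
  let ?c = "\<lambda>b. cutd (coord b ((T ^^ n) x))"
  define m where "m = min (rad n x) (min (?c True) (?c False))"
  have rs: "rad (Suc n) x = 19/10 * m" by (simp add: m_def coord_def)
  then have m0: "0 < m" using assms by simp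
  have cut: "ennreal (?c b powr (-1/4)) \<le> penalty n x + (line_penalty b n x - penalty n x) * indicator (near b n) x + ennreal 4" for b
  proof (cases "x \<in> near b n")
    case True
    then have "ennreal (?c b powr (-1/4)) = line_penalty b n x" by (simp add: line_penalty_def near_def cutd_def)
    also have "\<dots> \<le> penalty n x + (line_penalty b n x - penalty n x)" by (rule ennreal_le_add_diff)
    finally show ?thesis using True by (simp add: add_increasing2)
  next
    case False
    then have c: "?c b = 1/256" by (simp add: near_def cutd_def)
    have "ennreal (?c b powr (-1/4)) = ennreal 4" unfolding c powr_256 ..
    then show ?thesis using False by (simp add: add_increasing)
  qed
  have "ennreal (m powr (-1/4)) \<le> penalty n x + (line_penalty True n x - penalty n x) * indicator (near True n) x
    + (line_penalty False n x - penalty n x) * indicator (near False n) x + ennreal 4" (is "_ \<le> ?R")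
  proof -
    have "m = rad n x \<or> m = ?c True \<or> m = ?c False" by (simp add: m_def min_def)
    then consider "m = rad n x" | "m = ?c True" | "m = ?c False" by blast
    then show ?thesis
    proof cases
      case 1 then show ?thesis by (simp add: penalty_def add_increasing2 add.assoc)
    next
      case 2 show ?thesis unfolding 2 by (rule order_trans[OF cut[of True]], rule add_right_mono, simp add: add_increasing2)
    next
      case 3 show ?thesis unfolding 3 by (rule order_trans[OF cut[of False]]) (intro add_mono order_refl, simp add: add_increasing2)
    qed
  qed
  then have "ennreal \<kappa> * ennreal (m powr (-1/4)) \<le> ennreal \<kappa> * ?R" by (rule mult_left_mono) simp
  moreover have "penalty (Suc n) x = ennreal \<kappa> * ennreal (m powr (-1/4))"
    unfolding penalty_def rs \<kappa>_def using m0 by (subst powr_mult) (simp_all add: ennreal_mult)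
  ultimately show ?thesis by simp
qed

text \<open>Radii grow by at most 19/10 per step. This lets a later energy pay for cuts made
  earlier.\<close>

lemma penalty_Suc_ge:
  assumes "0 < rad (Suc n) x"
  shows "ennreal \<kappa> * penalty n x \<le> penalty (Suc n) x"
proof -
  have le: "rad (Suc n) x \<le> 19/10 * rad n x" by simp
  then have "0 < rad n x" using assms by linarith
  have "\<kappa> * rad n x powr (-1/4) = (19/10 * rad n x) powr (-1/4)" unfolding \<kappa>_def using \<open>0 < rad n x\<close> by (subst powr_mult) simp_all
  also have "\<dots> \<le> rad (Suc n) x powr (-1/4)" using assms le by (intro powr_mono2') auto
  finally show ?thesis unfolding penalty_def by (simp add: \<kappa>_def ennreal_mult[symmetric] ennreal_leI)
qed

definition near_energy :: "bool \<Rightarrow> nat \<Rightarrow> ennreal" where "near_energy b n = (\<integral>\<^sup>+x\<in>U. (penalty n x * indicator (near b n) x) \<partial>lborel)"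

lemma kappa_le_1: "\<kappa> \<le> 1" unfolding \<kappa>_def using powr_mono2'[of "-1/4" 1 "19/10 :: real"] by simp

lemma energy_Suc: "energy (Suc n) \<le> ennreal \<kappa> * (energy n + ennreal 0.2 * (near_energy True n + near_energy False n)) + ennreal 16 * emeasure lborel U"
proof -
  let ?r = "\<lambda>b x. (line_penalty b n x - penalty n x) * indicator (near b n) x"
  have "energy (Suc n) \<le> (\<integral>\<^sup>+x. ennreal \<kappa> * (penalty n x * indicator U x + ?r True x * indicator U x + ?r False x * indicator U x + ennreal 4 * indicator U x) \<partial>lborel)"
    unfolding energy_def
  proof (rule nn_integral_mono_AE, use AE_good in eventually_elim)
    case (elim x)
    then show ?case using penalty_Suc_le[of n x] by (cases "x \<in> U") (simp_all del: rad.simps)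
  qed
  also have "\<dots> = ennreal \<kappa> * (energy n + (\<integral>\<^sup>+x\<in>U. ?r True x \<partial>lborel) + (\<integral>\<^sup>+x\<in>U. ?r False x \<partial>lborel) + ennreal 4 * emeasure lborel U)"
    unfolding energy_def by (simp add: nn_integral_add nn_integral_cmult)
  also have "\<dots> \<le> ennreal \<kappa> * (energy n + (ennreal 0.2 * near_energy True n + ennreal 6 * emeasure lborel U) + (ennreal 0.2 * near_energy False n + ennreal 6 * emeasure lborel U) + ennreal 4 * emeasure lborel U)"
    unfolding near_energy_def by (intro mult_left_mono add_mono cut_cost_U order_refl) simp
  also have "\<dots> = ennreal \<kappa> * (energy n + ennreal 0.2 * (near_energy True n + near_energy False n)) + ennreal \<kappa> * ((ennreal 6 + ennreal 6 + ennreal 4) * emeasure lborel U)"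
    by (simp only: distrib_left distrib_right add_ac)
  also have "\<dots> \<le> ennreal \<kappa> * (energy n + ennreal 0.2 * (near_energy True n + near_energy False n)) + ennreal 1 * (ennreal 16 * emeasure lborel U)"
    using kappa_le_1 by (intro add_mono mult_mono order_refl ennreal_leI) (auto simp flip: ennreal_plus)
  finally show ?thesis by simp
qed

lemma near_energy_le: "near_energy b n \<le> energy n"
  unfolding near_energy_def energy_def by (intro nn_integral_mono) (auto simp: indicator_def)

lemma nn_integral_U_product_finite:
  assumes [measurable]: "f \<in> borel_measurable borel" and fin: "(\<integral>\<^sup>+t. f t \<partial>lborel) < \<infinity>"
  shows "(\<integral>\<^sup>+x\<in>U. f (coord b x) \<partial>lborel) < \<infinity>"
proof -
  have [measurable]: "{a1<..<b1} \<in> sets borel" "{a2<..<b2} \<in> sets borel" by auto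
  have m: "(\<lambda>x. f (coord b x) * indicator U x) \<in> borel_measurable borel" by measurable
  have ind: "indicator U (x, y) = (indicator {a1<..<b1} x * indicator {a2<..<b2} y :: ennreal)" for x y
    by (auto simp: U_def indicator_def)
  show ?thesis
  proof (cases b)
    case True
    have "(\<integral>\<^sup>+x\<in>U. f (coord b x) \<partial>lborel) = (\<integral>\<^sup>+y. \<integral>\<^sup>+x. (f x * indicator {a1<..<b1} x) * indicator {a2<..<b2} y \<partial>lborel \<partial>lborel)"
      unfolding nn_integral_lborel_pair(2)[OF m] by (simp add: ind coord_def True mult_ac)
    also have "\<dots> = (\<integral>\<^sup>+x\<in>{a1<..<b1}. f x \<partial>lborel) * ennreal (b2 - a2)"
      using box2 by (simp add: nn_integral_multc nn_integral_cmult)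
    also have "\<dots> \<le> (\<integral>\<^sup>+x. f x \<partial>lborel) * ennreal (b2 - a2)"
      by (intro mult_right_mono nn_integral_mono) (auto simp: indicator_def)
    also have "\<dots> < \<infinity>" using fin by (simp add: ennreal_mult_less_top)
    finally show ?thesis .
  next
    case False
    have "(\<integral>\<^sup>+x\<in>U. f (coord b x) \<partial>lborel) = (\<integral>\<^sup>+x. \<integral>\<^sup>+y. (f y * indicator {a2<..<b2} y) * indicator {a1<..<b1} x \<partial>lborel \<partial>lborel)"
      unfolding nn_integral_lborel_pair(1)[OF m] by (simp add: ind coord_def False mult_ac)
    also have "\<dots> = (\<integral>\<^sup>+x\<in>{a2<..<b2}. f x \<partial>lborel) * ennreal (b1 - a1)"
      using box1 by (simp add: nn_integral_multc nn_integral_cmult)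
    also have "\<dots> \<le> (\<integral>\<^sup>+x. f x \<partial>lborel) * ennreal (b1 - a1)"
      by (intro mult_right_mono nn_integral_mono) (auto simp: indicator_def)
    also have "\<dots> < \<infinity>" using fin by (simp add: ennreal_mult_less_top)
    finally show ?thesis .
  qed
qed

text \<open>The initial radius is the distance to one of the four sides of the box, and a power
  above -1 of each such distance is integrable.\<close>

lemma energy_0_finite: "energy 0 < \<infinity>"
proof -
  let ?g = "\<lambda>t::real. ennreal (t powr (-1/4)) * indicator {0<..<1} t"
  have g: "(\<integral>\<^sup>+t. ?g t \<partial>lborel) < \<infinity>" using nn_integral_powr_neg_quarter[of 1] by simp
  have l: "(\<integral>\<^sup>+t. ?g (t - a) \<partial>lborel) < \<infinity>" and r: "(\<integral>\<^sup>+t. ?g (a - t) \<partial>lborel) < \<infinity>" for a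
    using g nn_integral_lborel_shift[of ?g "-a"] nn_integral_lborel_reflect[of ?g a] by simp_all
  have "energy 0 \<le> (\<integral>\<^sup>+x. ?g (coord True x - a1) * indicator U x + ?g (b1 - coord True x) * indicator U x
     + ?g (coord False x - a2) * indicator U x + ?g (b2 - coord False x) * indicator U x \<partial>lborel)"
    unfolding energy_def
  proof (rule nn_integral_mono)
    fix x
    show "penalty 0 x * indicator U x \<le> ?g (coord True x - a1) * indicator U x + ?g (b1 - coord True x) * indicator U x
     + ?g (coord False x - a2) * indicator U x + ?g (b2 - coord False x) * indicator U x"
    proof (cases "x \<in> U")
      case True
      then have x: "a1 < fst x" "fst x < b1" "a2 < snd x" "snd x < b2" by (auto simp: U_def)
      consider "rad 0 x = fst x - a1" | "rad 0 x = b1 - fst x" | "rad 0 x = snd x - a2" | "rad 0 x = b2 - snd x"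
        unfolding rad.simps min_def by metis
      then show ?thesis
        using x box1 box2 True unfolding penalty_def coord_def
        by cases (simp_all add: add_increasing add_increasing2 del: rad.simps)
    qed simp
  qed
  also have "\<dots> = (\<integral>\<^sup>+x\<in>U. ?g (coord True x - a1) \<partial>lborel) + (\<integral>\<^sup>+x\<in>U. ?g (b1 - coord True x) \<partial>lborel)
     + (\<integral>\<^sup>+x\<in>U. ?g (coord False x - a2) \<partial>lborel) + (\<integral>\<^sup>+x\<in>U. ?g (b2 - coord False x) \<partial>lborel)"
    by (simp add: nn_integral_add)
  also have "\<dots> < \<infinity>"
    using nn_integral_U_product_finite[of "\<lambda>t. ?g (t - a1)" True, OF _ l] nn_integral_U_product_finite[of "\<lambda>t. ?g (b1 - t)" True, OF _ r]
      nn_integral_U_product_finite[of "\<lambda>t. ?g (t - a2)" False, OF _ l] nn_integral_U_product_finite[of "\<lambda>t. ?g (b2 - t)" False, OF _ r]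
    by (simp add: ennreal_add_less_top)
  finally show ?thesis .
qed

lemma energy_finite: "energy n < \<infinity>"
proof (induction n)
  case (Suc n)
  have "near_energy b n < \<infinity>" for b using near_energy_le[of b n] Suc by (rule le_less_trans)
  then have "ennreal \<kappa> * (energy n + ennreal 0.2 * (near_energy True n + near_energy False n)) + ennreal 16 * emeasure lborel U < \<infinity>"
    using Suc emeasure_U_finite by (simp add: ennreal_mult_less_top ennreal_add_less_top)
  then show ?case using energy_Suc[of n] by (rule le_less_trans[rotated])
qed (rule energy_0_finite)

end

subsection \<open>Growth of the images\<close>

text \<open>Chosen so that a radius below 1/\<open>grid\<close> costs a penalty above 4000. Against
  an energy of at most 1000 times the area, Markov's inequality leaves at most a quarter of the box
  with such radii.\<close>

definition grid :: nat where "grid = 4000 ^ 4"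

lemma grid_pos: "0 < grid" by (simp add: grid_def)

lemma ennreal_cost_eq:
  assumes "0 \<le> k" "0 \<le> a" "0 \<le> t" "0 \<le> b" "0 \<le> d" "0 \<le> y" "0 \<le> (u::real)"
  shows "ennreal k * (ennreal a + ennreal t * (ennreal b + ennreal d)) + ennreal y * ennreal u
    = ennreal (k * (a + t * (b + d)) + y * u)"
  using assms by (simp add: ennreal_plus ennreal_mult)

text \<open>Open cells are disjoint and have the shape of the box \<open>U\<close>; they cover the
  square up to the null set of grid lines.\<close>

definition cell :: "nat \<Rightarrow> nat \<times> nat \<Rightarrow> (real \<times> real) set" where
  "cell m k = {real (fst k) / real m<..<(real (fst k) + 1) / real m} \<times> {real (snd k) / real m<..<(real (snd k) + 1) / real m}"

abbreviation cells :: "nat \<Rightarrow> (nat \<times> nat) set" where "cells m \<equiv> {..<m} \<times> {..<m}"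

context boxed_tents
begin

lemma kappa_nonneg[simp]: "0 \<le> \<kappa>" by (simp add: \<kappa>_def)

text \<open>Real values are used because the four-step estimate subtracts a multiple of the new
  energy from both sides; \<open>energy_finite\<close> ensures that \<open>enn2real\<close> loses
  nothing.\<close>

definition energy_real :: "nat \<Rightarrow> real" where "energy_real n = enn2real (energy n)"
definition near_energy_real :: "bool \<Rightarrow> nat \<Rightarrow> real" where "near_energy_real b n = enn2real (near_energy b n)"

lemma energy_eq: "energy n = ennreal (energy_real n)" and near_energy_eq: "near_energy b n = ennreal (near_energy_real b n)"
  unfolding energy_real_def near_energy_real_def using energy_finite[of n] le_less_trans[OF near_energy_le energy_finite, of b n] by simp_all

lemma energy_real_nonneg: "0 \<le> energy_real n" and near_energy_real_nonneg: "0 \<le> near_energy_real b n" by (simp_all add: energy_real_def near_energy_real_def)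

lemma energy_real_Suc: "energy_real (Suc n) \<le> \<kappa> * (energy_real n + 0.2 * (near_energy_real True n + near_energy_real False n)) + 16 * area"
proof -
  note nn = energy_real_nonneg[of n] near_energy_real_nonneg[of True n] near_energy_real_nonneg[of False n] area_pos
  have k: "0 \<le> \<kappa>" by (simp add: \<kappa>_def)
  have "ennreal (energy_real (Suc n)) \<le> ennreal (\<kappa> * (energy_real n + 0.2 * (near_energy_real True n + near_energy_real False n)) + 16 * area)"
    using energy_Suc[of n] unfolding energy_eq near_energy_eq emeasure_U
    by (subst (asm) ennreal_cost_eq) (use nn k in auto)
  then show ?thesis
    using nn k by (subst (asm) ennreal_le_iff) (auto intro!: add_nonneg_nonneg mult_nonneg_nonneg)
qed

lemma penalty_add_ge:
  assumes "\<And>n. 0 < rad n x" shows "ennreal (\<kappa> ^ k) * penalty n x \<le> penalty (n + k) x"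
proof (induction k)
  case (Suc k)
  have "ennreal (\<kappa> ^ Suc k) * penalty n x = ennreal \<kappa> * (ennreal (\<kappa> ^ k) * penalty n x)"
    by (simp add: ennreal_mult mult.assoc)
  also have "\<dots> \<le> ennreal \<kappa> * penalty (n + k) x" by (intro mult_left_mono Suc) simp
  also have "\<dots> \<le> penalty (n + Suc k) x" using penalty_Suc_ge[of "n + k" x] assms[of "Suc (n + k)"] by (simp del: rad.simps)
  finally show ?case .
qed simp

text \<open>Within four consecutive steps an orbit is close to each of the two singular lines at most once, so the
  four cutting costs are together dominated by a single copy of the final energy.\<close>

lemma sum_near_energy_le: "(\<Sum>k<4. \<kappa> ^ (4 - k) * near_energy_real b (n + k)) \<le> energy_real (n + 4)"
proof -
  have ptw: "AE x in lborel. (\<Sum>k<4. ennreal (\<kappa> ^ (4 - k)) * (penalty (n + k) x * indicator (near b (n + k)) x * indicator U x)) \<le> penalty (n + 4) x * indicator U x"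
    using AE_good
  proof eventually_elim
    case (elim x)
    show ?case
    proof (cases "x \<in> U \<and> (\<exists>k<4. x \<in> near b (n + k))")
      case True
      then obtain k where k: "k < 4" "x \<in> near b (n + k)" by auto
      have xU: "x \<in> U" using True by simp
      have one: "x \<notin> near b (n + l)" if "l < 4" "l \<noteq> k" for l
      proof -
        have no: "\<not> (x \<in> near b (n + i) \<and> x \<in> near b (n + j))" if "i < j" "j < 4" for i j
        proof -
          have "(T ^^ (j - i)) ((T ^^ (n + i)) x) = (T ^^ (n + j)) x"
            using that by (simp add: comp_apply[of "T ^^ _", symmetric] funpow_add[symmetric] add.commute)
          moreover have "(T ^^ (n + i)) x \<in> unit_square" using xU U_subset T_pow_unit_square by blast
          ultimately show ?thesis using no_return[of "(T ^^ (n + i)) x" b "j - i"] that unfolding near_def by auto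
        qed
        show ?thesis using no[of l k] no[of k l] k that by (cases l k rule: linorder_cases) auto
      qed
      have "(\<Sum>k<4. ennreal (\<kappa> ^ (4 - k)) * (penalty (n + k) x * indicator (near b (n + k)) x * indicator U x))
        = (\<Sum>l<4. if l = k then ennreal (\<kappa> ^ (4 - k)) * penalty (n + k) x else 0)"
        using one k xU by (intro sum.cong) auto
      also have "\<dots> = ennreal (\<kappa> ^ (4 - k)) * penalty (n + k) x" using k by (subst sum.delta) auto
      also have "\<dots> \<le> penalty (n + 4) x" using penalty_add_ge[of x "4 - k" "n + k"] elim xU k by simp
      finally show ?thesis using xU by simp
    next
      case False
      then have z: "(\<Sum>k<4. ennreal (\<kappa> ^ (4 - k)) * (penalty (n + k) x * indicator (near b (n + k)) x * indicator U x)) = 0"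
        by (intro sum.neutral) auto
      show ?thesis unfolding z by simp
    qed
  qed
  have "ennreal (\<Sum>k<4. \<kappa> ^ (4 - k) * near_energy_real b (n + k)) = (\<Sum>k<4. ennreal (\<kappa> ^ (4 - k)) * near_energy b (n + k))"
    unfolding near_energy_eq using near_energy_real_nonneg by (simp add: sum_ennreal[symmetric] ennreal_mult)
  also have "\<dots> = (\<Sum>k<4. \<integral>\<^sup>+x. ennreal (\<kappa> ^ (4 - k)) * (penalty (n + k) x * indicator (near b (n + k)) x * indicator U x) \<partial>lborel)"
    unfolding near_energy_def by (simp add: nn_integral_cmult)
  also have "\<dots> = (\<integral>\<^sup>+x. (\<Sum>k<4. ennreal (\<kappa> ^ (4 - k)) * (penalty (n + k) x * indicator (near b (n + k)) x * indicator U x)) \<partial>lborel)"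
    by (rule nn_integral_sum[symmetric]) measurable
  also have "\<dots> \<le> energy (n + 4)" unfolding energy_def using ptw by (rule nn_integral_mono_AE)
  finally show ?thesis unfolding energy_eq using energy_real_nonneg by simp
qed

lemma kappa_4: "\<kappa> ^ 4 = 10/19"
proof -
  have "\<kappa> ^ 4 = \<kappa> powr 4" by (subst powr_numeral) (auto simp: \<kappa>_def)
  also have "\<dots> = (19/10) powr (-1)" unfolding \<kappa>_def by (simp only: powr_powr) simp
  finally show ?thesis by (simp add: powr_minus_divide)
qed

text \<open>After four iterations each line contributes at most
  \<open>0.2 * energy_real (n + 4)\<close>. Moving both contributions to the left leaves the
  coefficient 0.6, whence 50/57 = (10/19)/0.6, and 64/0.6 is below 110.\<close>

lemma energy_real_four_steps: "energy_real (n + 4) \<le> 50/57 * energy_real n + 110 * area"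
proof -
  have k: "0 \<le> \<kappa>" "\<kappa> \<le> 1" using kappa_le_1 by (auto simp: \<kappa>_def)
  define S where "S n = 0.2 * (near_energy_real True n + near_energy_real False n)" for n
  have step: "energy_real (Suc n) \<le> \<kappa> * (energy_real n + S n) + 16 * area" for n using energy_real_Suc[of n] by (simp add: S_def)
  have it: "energy_real (n + j) \<le> \<kappa> ^ j * energy_real n + (\<Sum>i<j. \<kappa> ^ (j - i) * S (n + i)) + 16 * real j * area" for j
  proof (induction j)
    case (Suc j)
    have "(\<Sum>i<Suc j. \<kappa> ^ (Suc j - i) * S (n + i)) = \<kappa> * (\<Sum>i<j. \<kappa> ^ (j - i) * S (n + i)) + \<kappa> * S (n + j)"
      by (simp add: sum_distrib_left Suc_diff_le mult.assoc)
    moreover have "\<kappa> * energy_real (n + j) \<le> \<kappa> * (\<kappa> ^ j * energy_real n + (\<Sum>i<j. \<kappa> ^ (j - i) * S (n + i)) + 16 * real j * area)"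
      by (intro mult_left_mono Suc k)
    moreover have "\<kappa> * (16 * real j * area) \<le> 1 * (16 * real j * area)"
      using k area_pos by (intro mult_right_mono) auto
    ultimately show ?case using step[of "n + j"] by (simp add: algebra_simps)
  qed simp
  have "(\<Sum>i<4. \<kappa> ^ (4 - i) * S (n + i)) = 0.2 * ((\<Sum>i<4. \<kappa> ^ (4 - i) * near_energy_real True (n + i)) + (\<Sum>i<4. \<kappa> ^ (4 - i) * near_energy_real False (n + i)))"
    unfolding S_def sum.distrib[symmetric] sum_distrib_left by (intro sum.cong refl) (simp add: algebra_simps)
  also have "\<dots> \<le> 0.2 * (energy_real (n + 4) + energy_real (n + 4))" by (intro mult_left_mono add_mono sum_near_energy_le) simp
  finally have "energy_real (n + 4) \<le> 10/19 * energy_real n + 0.4 * energy_real (n + 4) + 64 * area"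
    using it[of 4] unfolding kappa_4 by simp
  then show ?thesis using area_pos by simp
qed

text \<open>900 lies above the fixed point 110/(1 - 50/57) of the recursion. The remaining 100
  absorbs the decayed initial energy, which is finite but depends on the box, and so does the time
  \<open>n\<close>.\<close>

lemma energy_real_bound: "\<exists>n. energy_real n \<le> 1000 * area"
proof -
  have b: "energy_real (4 * k) \<le> (50/57) ^ k * energy_real 0 + 900 * area" for k
  proof (induction k)
    case (Suc k)
    have "energy_real (4 * Suc k) = energy_real (4 * k + 4)" by (simp add: add.commute)
    also have "\<dots> \<le> 50/57 * ((50/57) ^ k * energy_real 0 + 900 * area) + 110 * area"
      by (rule order_trans[OF energy_real_four_steps]) (intro add_right_mono mult_left_mono Suc, simp)
    also have "\<dots> \<le> (50/57) ^ Suc k * energy_real 0 + 900 * area" using area_pos by (simp add: algebra_simps)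
    finally show ?case .
  qed (use area_pos in simp)
  obtain k where k: "(50/57 :: real) ^ k < 100 * area / (energy_real 0 + 1)"
    using real_arch_pow_inv[of "100 * area / (energy_real 0 + 1)" "50/57"] area_pos energy_real_nonneg[of 0] by auto
  have "(50/57) ^ k * energy_real 0 \<le> (50/57) ^ k * (energy_real 0 + 1)" by (intro mult_left_mono) auto
  also have "\<dots> \<le> 100 * area" using k energy_real_nonneg[of 0] by (simp add: pos_less_divide_eq less_imp_le)
  finally show ?thesis using b[of k] by (intro exI[of _ "4 * k"]) linarith
qed

lemma large_scale: "\<exists>n. emeasure lborel {x \<in> U. rad n x < 1 / real grid} \<le> ennreal (1/4) * emeasure lborel U"
proof -
  obtain n where n: "energy_real n \<le> 1000 * area" using energy_real_bound by auto
  let ?B = "{x \<in> U. rad n x < 1 / real grid}"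
  have B[measurable]: "?B \<in> sets borel"
  proof -
    have "?B = U \<inter> {x. rad n x < 1 / real grid}" by auto
    also have "\<dots> \<in> sets borel" by measurable
    finally show ?thesis .
  qed
  have t: "(1 / real grid) powr (-1/4) = 4000"
  proof -
    have "1 / real grid = 4000 powr (-4)" by (simp add: grid_def powr_minus_divide)
    then show ?thesis by (simp only: powr_powr) simp
  qed
  have "ennreal 4000 * emeasure lborel ?B = (\<integral>\<^sup>+x. ennreal 4000 * indicator ?B x \<partial>lborel)"
    by (simp add: nn_integral_cmult_indicator)
  also have "\<dots> \<le> energy n"
    unfolding energy_def
  proof (rule nn_integral_mono_AE, use AE_good in eventually_elim)
    case (elim x)
    show ?case
    proof (cases "x \<in> ?B")
      case True
      then have "(1 / real grid) powr (-1/4) \<le> rad n x powr (-1/4)"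
        using elim by (intro powr_mono2') auto
      then have "ennreal 4000 \<le> penalty n x" unfolding t penalty_def by (rule ennreal_leI)
      then show ?thesis using True by simp
    qed simp
  qed
  also have "\<dots> \<le> ennreal (1000 * area)" unfolding energy_eq using n by (rule ennreal_leI)
  finally have le: "ennreal 4000 * emeasure lborel ?B \<le> ennreal (1000 * area)" .
  have "emeasure lborel ?B \<le> emeasure lborel U" by (intro emeasure_mono) auto
  then have "emeasure lborel ?B < \<infinity>" using emeasure_U_finite by (rule le_less_trans)
  then obtain x where x: "emeasure lborel ?B = ennreal x" "0 \<le> x" by (cases "emeasure lborel ?B" rule: ennreal_cases) auto
  have "ennreal (4000 * x) \<le> ennreal (1000 * area)" using le unfolding x(1) using x(2) by (subst ennreal_mult) auto
  then have "4000 * x \<le> 1000 * area" using area_pos by (subst (asm) ennreal_le_iff) auto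
  then have "emeasure lborel ?B \<le> ennreal (1/4 * area)" unfolding x by (intro ennreal_leI) simp
  also have "\<dots> = ennreal (1/4) * emeasure lborel U" unfolding emeasure_U using area_pos by (intro ennreal_mult) auto
  finally have "emeasure lborel ?B \<le> ennreal (1/4) * emeasure lborel U" .
  then show ?thesis ..
qed

end

lemma open_cell: "open (cell m k)" unfolding cell_def by (intro open_Times) auto

lemma sets_cell[measurable]: "cell m k \<in> sets borel" using open_cell by auto

lemma cell_disjoint: "x \<in> cell m k \<Longrightarrow> x \<in> cell m l \<Longrightarrow> k = l"
  by (cases "m = 0") (auto simp: cell_def prod_eq_iff pos_divide_less_eq pos_less_divide_eq)

lemma cell_supd: "x \<in> cell m k \<Longrightarrow> y \<in> cell m k \<Longrightarrow> supd x y < 1 / real m"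
  unfolding cell_def supd_def max_less_iff_conj abs_less_iff
  by (cases "m = 0") (auto simp: mem_Times_iff field_simps)

lemma ex_cell:
  assumes m: "0 < m" and x: "x \<in> unit_square" and g: "\<And>k::nat. fst x \<noteq> real k / real m \<and> snd x \<noteq> real k / real m"
  shows "\<exists>k\<in>cells m. x \<in> cell m k"
proof -
  have one: "\<exists>k<m. t \<in> {real k / real m<..<(real k + 1) / real m}"
    if t: "t \<in> {0..1}" "\<And>k::nat. t \<noteq> real k / real m" for t :: real
  proof -
    define k where "k = nat \<lfloor>t * real m\<rfloor>"
    have t0: "0 \<le> t * real m" using t by simp
    have k: "real k \<le> t * real m" "t * real m < real k + 1"
      unfolding k_def using t0 by (simp_all add: of_nat_nat)
    have "t * real m \<noteq> real k" using t(2)[of k] m by (auto simp: field_simps)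
    with k have lt: "real k < t * real m" by simp
    have "t * real m \<le> real m" using t by (simp add: mult_left_le_one_le)
    then have "real k < real m" using lt by simp
    then have "k < m" by (simp only: of_nat_less_iff)
    then show ?thesis using lt k(2) m by (intro exI[of _ k]) (simp add: divide_less_eq less_divide_eq)
  qed
  obtain i j where "i < m" "j < m" "fst x \<in> {real i / real m<..<(real i + 1) / real m}"
    "snd x \<in> {real j / real m<..<(real j + 1) / real m}"
    using one[of "fst x"] one[of "snd x"] x g by (auto simp: unit_square_def)
  then show ?thesis by (intro bexI[of _ "(i, j)"]) (auto simp: cell_def mem_Times_iff)
qed

lemma AE_off_grid: "AE x :: real \<times> real in lborel. \<forall>k::nat. fst x \<noteq> real k / real m \<and> snd x \<noteq> real k / real m"
  unfolding AE_all_countable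
proof
  fix k
  show "AE x :: real \<times> real in lborel. fst x \<noteq> real k / real m \<and> snd x \<noteq> real k / real m"
    using AE_not_vertical[of "real k / real m"] AE_not_horizontal[of "real k / real m"] by eventually_elim auto
qed

context coupled_tents
begin

lemma AE_ex_cell:
  assumes "0 < m" shows "AE x in lborel. x \<in> unit_square \<longrightarrow> (\<exists>k\<in>cells m. (T ^^ n) x \<in> cell m k)"
proof -
  have "AE x in lborel. \<forall>k::nat. fst ((T ^^ n) x) \<noteq> real k / real m \<and> snd ((T ^^ n) x) \<noteq> real k / real m"
    by (rule AE_T_pow) (rule AE_off_grid)
  then show ?thesis by eventually_elim (use ex_cell[OF assms] T_pow_unit_square in blast)
qed

end

context boxed_tents
begin

text \<open>Where the radius is at least 1/\<open>grid\<close>, the whole grid cell about the image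
  point lies in \<open>D w\<close>, and with it the part of that cell outside \<open>S\<close>.
  These parts are pulled back to \<open>U\<close> with bounded distortion.\<close>

lemma escape_fraction:
  assumes S: "closed S" "T ` S \<subseteq> S" and \<rho>: "0 \<le> \<rho>"
    and hole: "\<And>k. k \<in> cells grid \<Longrightarrow> ennreal \<rho> * emeasure lborel (cell grid k) \<le> emeasure lborel (cell grid k - S)"
  shows "ennreal (\<rho> / 2) * emeasure lborel U \<le> emeasure lborel (U - S)"
proof -
  have [measurable]: "S \<in> sets borel" using S(1) by auto
  have TS: "x \<in> S \<Longrightarrow> (T ^^ n) x \<in> S" for x n using S(2) by (induction n) auto
  obtain n where n: "emeasure lborel {x \<in> U. rad n x < 1 / real grid} \<le> ennreal (1/4) * emeasure lborel U"
    using large_scale by auto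
  have fin: "finite (cells grid)" by (intro finite_cartesian_product finite_lessThan)
  let ?B = "{x. 1 / real grid \<le> rad n x}"
  have word: "(\<integral>\<^sup>+x\<in>W w. (ennreal \<rho> * indicator ?B x) \<partial>lborel) \<le> (\<integral>\<^sup>+x\<in>W w. (ennreal (105/100) * indicator (- S) x) \<partial>lborel)"
    if w: "length w = n" for w
  proof -
    define C where "C = {k \<in> cells grid. cell grid k \<subseteq> D w}"
    have finC: "finite C" unfolding C_def using fin by simp
    have [measurable]: "(\<Union>k\<in>C. cell grid k) \<in> sets borel" "(\<Union>k\<in>C. cell grid k - S) \<in> sets borel"
      using finC by (auto intro!: sets.finite_UN)
    have sub: "(\<Union>k\<in>C. cell grid k) \<subseteq> D w" unfolding C_def by auto
    have "ennreal \<rho> * emeasure lborel (\<Union>k\<in>C. cell grid k) \<le> ennreal \<rho> * (\<Sum>k\<in>C. emeasure lborel (cell grid k))"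
      using finC by (intro mult_left_mono emeasure_subadditive_finite) auto
    also have "\<dots> = (\<Sum>k\<in>C. ennreal \<rho> * emeasure lborel (cell grid k))" by (rule sum_distrib_left)
    also have "\<dots> \<le> (\<Sum>k\<in>C. emeasure lborel (cell grid k - S))" using hole by (intro sum_mono) (simp add: C_def)
    also have "\<dots> = emeasure lborel (\<Union>k\<in>C. cell grid k - S)"
      using finC by (intro sum_emeasure) (auto simp: disjoint_family_on_def dest: cell_disjoint)
    finally have le: "ennreal \<rho> * emeasure lborel (\<Union>k\<in>C. cell grid k) \<le> emeasure lborel (\<Union>k\<in>C. cell grid k - S)" .
    have "(\<integral>\<^sup>+y\<in>D w. (ennreal \<rho> * indicator (\<Union>k\<in>C. cell grid k) y) \<partial>lborel) \<le> (\<integral>\<^sup>+y. ennreal \<rho> * indicator (\<Union>k\<in>C. cell grid k) y \<partial>lborel)"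
      by (intro nn_integral_mono) (auto simp: indicator_def)
    also have "\<dots> \<le> (\<integral>\<^sup>+y. indicator (\<Union>k\<in>C. cell grid k - S) y \<partial>lborel)" using le by (simp add: nn_integral_cmult_indicator)
    also have "\<dots> = (\<integral>\<^sup>+y\<in>D w. indicator (\<Union>k\<in>C. cell grid k - S) y \<partial>lborel)"
      using sub by (intro nn_integral_cong) (auto simp: indicator_def)
    finally have tr: "(\<integral>\<^sup>+x\<in>W w. (ennreal \<rho> * indicator (\<Union>k\<in>C. cell grid k) ((T ^^ length w) x)) \<partial>lborel)
      \<le> ennreal (105/100) * (\<integral>\<^sup>+x\<in>W w. indicator (\<Union>k\<in>C. cell grid k - S) ((T ^^ length w) x) \<partial>lborel)"
      by (intro transfer) measurable
    have "(\<integral>\<^sup>+x\<in>W w. (ennreal \<rho> * indicator ?B x) \<partial>lborel) \<le> (\<integral>\<^sup>+x\<in>W w. (ennreal \<rho> * indicator (\<Union>k\<in>C. cell grid k) ((T ^^ length w) x)) \<partial>lborel)"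
    proof (rule nn_integral_mono_AE, use AE_ex_cell[OF grid_pos, of n] in eventually_elim)
      case (elim x)
      show ?case
      proof (cases "x \<in> W w \<and> x \<in> ?B")
        case True
        then have "x \<in> unit_square" using W_subset U_subset by blast
        then obtain k where k: "k \<in> cells grid" "(T ^^ n) x \<in> cell grid k" using elim by auto
        have "cell grid k \<subseteq> D w"
        proof
          fix y assume "y \<in> cell grid k"
          then have "supd y ((T ^^ n) x) < 1 / real grid" using k cell_supd by blast
          then show "y \<in> D w" using True w rad_ball[of x w y] by simp
        qed
        then have "(T ^^ length w) x \<in> (\<Union>k\<in>C. cell grid k)" using k w unfolding C_def by blast
        then show ?thesis by (simp add: indicator_def)
      next
        case False
        then show ?thesis by (cases "x \<in> W w") simp_all
      qed
    qed
    also note tr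
    also have "ennreal (105/100) * (\<integral>\<^sup>+x\<in>W w. indicator (\<Union>k\<in>C. cell grid k - S) ((T ^^ length w) x) \<partial>lborel)
      = (\<integral>\<^sup>+x\<in>W w. (ennreal (105/100) * indicator (\<Union>k\<in>C. cell grid k - S) ((T ^^ length w) x)) \<partial>lborel)"
      by (subst nn_integral_cmult[symmetric]) (simp_all add: mult.assoc)
    \<comment> \<open>Invariance in contrapositive form: if an iterate lies outside
      \<open>S\<close>, so does the starting point.\<close>
    also have "\<dots> \<le> (\<integral>\<^sup>+x\<in>W w. (ennreal (105/100) * indicator (- S) x) \<partial>lborel)"
      using TS[of _ "length w"] by (intro nn_integral_mono) (auto simp: indicator_def)
    finally show ?thesis .
  qed
  have [measurable]: "?B \<in> sets borel" by measurable
  have "ennreal \<rho> * emeasure lborel (U \<inter> ?B) = (\<integral>\<^sup>+x\<in>U. (ennreal \<rho> * indicator ?B x) \<partial>lborel)"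
    by (simp add: nn_integral_cmult_indicator mult.assoc indicator_inter_arith[symmetric] Int_commute)
  also have "\<dots> = (\<Sum>w | length w = n. \<integral>\<^sup>+x\<in>W w. (ennreal \<rho> * indicator ?B x) \<partial>lborel)"
    by (rule nn_integral_U_words) measurable
  also have "\<dots> \<le> (\<Sum>w | length w = n. \<integral>\<^sup>+x\<in>W w. (ennreal (105/100) * indicator (- S) x) \<partial>lborel)"
    by (intro sum_mono word) simp
  also have "\<dots> = (\<integral>\<^sup>+x\<in>U. (ennreal (105/100) * indicator (- S) x) \<partial>lborel)"
    by (rule nn_integral_U_words[symmetric]) measurable
  also have "\<dots> = ennreal (105/100) * emeasure lborel (U - S)"
    by (simp add: nn_integral_cmult_indicator mult.assoc indicator_inter_arith[symmetric] Int_commute Diff_eq)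
  finally have 1: "ennreal \<rho> * emeasure lborel (U \<inter> ?B) \<le> ennreal (105/100) * emeasure lborel (U - S)" .
  define u where "u = measure lborel (U \<inter> ?B)"
  define v where "v = measure lborel (U - S)"
  have f: "emeasure lborel A < \<infinity>" if "A \<subseteq> U" for A using emeasure_mono[OF that, of lborel] emeasure_U_finite by (auto intro: le_less_trans)
  have u: "emeasure lborel (U \<inter> ?B) = ennreal u" and v: "emeasure lborel (U - S) = ennreal v"
    unfolding u_def v_def using f[of "U \<inter> ?B"] f[of "U - S"] by (auto intro!: emeasure_eq_ennreal_measure simp: less_top)
  have uv0: "0 \<le> u" "0 \<le> v" unfolding u_def v_def by auto
  have "emeasure lborel U \<le> emeasure lborel (U \<inter> ?B) + emeasure lborel {x \<in> U. rad n x < 1 / real grid}"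
  proof -
    have "{x \<in> U. rad n x < 1 / real grid} = U - ?B" by auto
    moreover have "emeasure lborel U = emeasure lborel (U \<inter> ?B) + emeasure lborel (U - ?B)"
      by (subst plus_emeasure) (auto intro!: arg_cong[where f="emeasure lborel"])
    ultimately show ?thesis by simp
  qed
  also have "\<dots> \<le> ennreal u + ennreal (1/4) * ennreal area" using n u emeasure_U by (simp add: add_left_mono)
  finally have "ennreal area \<le> ennreal (u + 1/4 * area)"
    unfolding emeasure_U using area_pos uv0 by (simp flip: ennreal_plus ennreal_mult)
  then have a: "area \<le> u + 1/4 * area" using area_pos uv0 by (subst (asm) ennreal_le_iff) auto
  have "ennreal (\<rho> * u) \<le> ennreal (105/100 * v)" using 1 u v uv0 \<rho> by (simp flip: ennreal_mult)
  then have b: "\<rho> * u \<le> 105/100 * v" using uv0 \<rho> by (subst (asm) ennreal_le_iff) auto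
  \<comment> \<open>At least three quarters of the box reach the large scale, and (3/4)/1.05 exceeds
    the claimed 1/2.\<close>
  have "\<rho> * (3/4 * area) \<le> \<rho> * u" using a \<rho> by (intro mult_left_mono) auto
  then have "\<rho> / 2 * area \<le> v" using b uv0 mult_nonneg_nonneg[OF \<rho> less_imp_le[OF area_pos]] by simp
  then show ?thesis unfolding v emeasure_U using \<rho> area_pos by (subst ennreal_mult[symmetric]) (auto intro: ennreal_leI)
qed

end

subsection \<open>Invariant closed sets\<close>

lemma emeasure_cell:
  assumes "0 < m" shows "emeasure lborel (cell m k) = ennreal (1 / real m * (1 / real m))"
proof -
  have l: "(t + 1) / real m - t / real m = 1 / real m" for t :: real by (simp add: diff_divide_distrib[symmetric])
  show ?thesis
    unfolding cell_def lborel_prod[symmetric]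
    by (subst lborel.emeasure_pair_measure_Times) (auto simp: divide_right_mono l simp flip: ennreal_mult)
qed

lemma cell_subset_unit_square: "k \<in> cells m \<Longrightarrow> cell m k \<subseteq> unit_square"
proof -
  assume "k \<in> cells m"
  then have *: "real (fst k) + 1 \<le> real m" "real (snd k) + 1 \<le> real m" by (auto simp: Suc_le_eq)
  then have m: "0 < real m" by (smt (verit) of_nat_0_le_iff)
  have "(real (fst k) + 1) / real m \<le> 1" "(real (snd k) + 1) / real m \<le> 1" using * m by (simp_all add: divide_le_eq)
  moreover have "0 \<le> real (fst k) / real m" "0 \<le> real (snd k) / real m" by simp_all
  ultimately show ?thesis unfolding cell_def unit_square_def
    by (intro Sigma_mono subsetI) (meson atLeastAtMost_iff greaterThanLessThan_iff less_imp_le order_trans)+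
qed

text \<open>An elementary substitute for the Lebesgue density theorem. If every cell lost the
  fraction \<open>\<epsilon>\<close>, the cells of a fine grid that meet \<open>S\<close> would
  leave area at least \<open>\<epsilon>\<close> times that of \<open>S\<close> in
  \<open>V - S\<close>, for an open \<open>V\<close> around \<open>S\<close> chosen by outer
  regularity to violate this. Compactness supplies a mesh whose cells meeting \<open>S\<close> stay
  in \<open>V\<close>.\<close>

lemma dense_cell:
  fixes S :: "(real \<times> real) set"
  assumes S: "compact S" "S \<subseteq> unit_square" "0 < emeasure lborel S" and \<epsilon>: "0 < \<epsilon>"
  shows "\<exists>m k. 0 < m \<and> k \<in> cells m \<and> emeasure lborel (cell m k - S) < ennreal \<epsilon> * emeasure lborel (cell m k)"
proof (rule ccontr)
  assume "\<not> ?thesis"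
  then have no: "ennreal \<epsilon> * emeasure lborel (cell m k) \<le> emeasure lborel (cell m k - S)" if "0 < m" "k \<in> cells m" for m k
    using that not_less by blast
  have clS: "closed S" using S(1) by (rule compact_imp_closed)
  have [measurable]: "S \<in> sets borel" using clS by auto
  have "0 < ennreal \<epsilon> * emeasure lborel S" using S(3) \<epsilon> by (simp add: ennreal_zero_less_mult_iff)
  moreover have "emeasure lborel S < \<infinity>" using S(1) by (rule emeasure_compact_finite)
  ultimately obtain r where r: "ennreal \<epsilon> * emeasure lborel S = ennreal r" "0 < r"
    by (cases "ennreal \<epsilon> * emeasure lborel S" rule: ennreal_cases) (auto simp: ennreal_mult_eq_top_iff)
  obtain V where V: "open V" "S \<subseteq> V" "emeasure lborel (V - S) < ennreal r"
    using outer_regular_lborel[of S r] r(2) by auto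
  obtain d where d: "0 < d" "(\<Union>x\<in>S. ball x d) \<subseteq> V"
    using compact_subset_open_imp_ball_epsilon_subset[OF S(1) V(1,2)] by blast
  obtain m :: nat where m: "2 / d < real m" using reals_Archimedean2 by blast
  then have m0: "0 < m" using d(1) by (cases m) (auto simp: divide_less_0_iff)
  have md: "2 / real m < d" using m d(1) m0 by (simp add: field_simps)
  define C where "C = {k \<in> cells m. cell m k \<inter> S \<noteq> {}}"
  have finC: "finite C" unfolding C_def by (rule finite_subset[of _ "cells m"]) auto
  have sub: "cell m k - S \<subseteq> V - S" if kC: "k \<in> C" for k
  proof -
    obtain x where x: "x \<in> cell m k" "x \<in> S" using kC unfolding C_def by blast
    have "y \<in> ball x d" if "y \<in> cell m k" for y
    proof -
      have "dist x y \<le> \<bar>fst x - fst y\<bar> + \<bar>snd x - snd y\<bar>"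
        unfolding dist_prod_def dist_real_def by (rule sqrt_sum_squares_le_sum) auto
      also have "\<dots> \<le> supd x y + supd x y" by (intro add_mono) (simp_all add: supd_def)
      also have "\<dots> < 2 / real m" using cell_supd[OF x(1) that] by simp
      finally show ?thesis using md by simp
    qed
    then show ?thesis using d(2) x(2) by blast
  qed
  have "emeasure lborel S \<le> emeasure lborel (\<Union>k\<in>C. cell m k)"
  proof (rule emeasure_mono_AE)
    show "AE x in lborel. x \<in> S \<longrightarrow> x \<in> (\<Union>k\<in>C. cell m k)"
      using AE_off_grid[of m]
    proof eventually_elim
      case (elim x)
      show ?case
      proof
        assume x: "x \<in> S"
        then obtain k where "k \<in> cells m" "x \<in> cell m k" using ex_cell[OF m0, of x] elim S(2) by blast
        then show "x \<in> (\<Union>k\<in>C. cell m k)" using x unfolding C_def by blast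
      qed
    qed
    show "(\<Union>k\<in>C. cell m k) \<in> sets lborel" using finC by (auto intro!: sets.finite_UN)
  qed
  also have "\<dots> \<le> (\<Sum>k\<in>C. emeasure lborel (cell m k))"
    using finC by (intro emeasure_subadditive_finite) auto
  finally have "ennreal \<epsilon> * emeasure lborel S \<le> ennreal \<epsilon> * (\<Sum>k\<in>C. emeasure lborel (cell m k))" by (rule mult_left_mono) simp
  also have "\<dots> = (\<Sum>k\<in>C. ennreal \<epsilon> * emeasure lborel (cell m k))" by (rule sum_distrib_left)
  also have "\<dots> \<le> (\<Sum>k\<in>C. emeasure lborel (cell m k - S))"
    using no[OF m0] by (intro sum_mono) (auto simp: C_def)
  also have "\<dots> = emeasure lborel (\<Union>k\<in>C. cell m k - S)"
    using finC by (intro sum_emeasure) (auto simp: disjoint_family_on_def dest: cell_disjoint)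
  also have "\<dots> \<le> emeasure lborel (V - S)"
    using sub V(1) by (intro emeasure_mono) auto
  also have "\<dots> < ennreal r" by (rule V(3))
  finally show False using r(1) by simp
qed

lemma (in coupled_tents) invariant_contains_cell:
  assumes S: "closed S" "S \<subseteq> unit_square" "T ` S \<subseteq> S" "0 < emeasure lborel S"
  shows "\<exists>k\<in>cells grid. cell grid k \<subseteq> S"
proof (rule ccontr)
  assume no: "\<not> ?thesis"
  have [measurable]: "S \<in> sets borel" using S(1) by auto
  have "compact unit_square" unfolding unit_square_def by (intro compact_Times) auto
  then have cS: "compact S" using S(1,2) closed_Int_compact[of S unit_square] by (simp add: inf.absorb1)
  have fin: "finite (cells grid)" "cells grid \<noteq> {}" using grid_pos by auto
  \<comment> \<open>The smallest hole among finitely many cells. Each hole is open and nonempty,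
    hence of positive area.\<close>
  define \<rho> where "\<rho> = Min ((\<lambda>k. measure lborel (cell grid k - S)) ` cells grid)"
  have f: "emeasure lborel (cell grid k - S) < \<infinity>" for k
    by (rule le_less_trans[OF emeasure_mono[of _ "cell grid k"]]) (auto simp: emeasure_cell[OF grid_pos])
  have em: "emeasure lborel (cell grid k - S) = ennreal (measure lborel (cell grid k - S))" for k
    using f[of k] by (intro emeasure_eq_ennreal_measure) auto
  have pos: "0 < measure lborel (cell grid k - S)" if "k \<in> cells grid" for k
  proof -
    have "open (cell grid k - S)" using open_cell S(1) by (rule open_Diff)
    moreover have "cell grid k - S \<noteq> {}" using no that by blast
    ultimately have "\<not> negligible (cell grid k - S)" by (rule open_not_negligible)
    then have "cell grid k - S \<notin> null_sets lborel"
      unfolding negligible_iff_null_sets using null_sets_completionI by blast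
    then have "emeasure lborel (cell grid k - S) \<noteq> 0" by (auto simp: null_sets_def)
    then show ?thesis unfolding em by (simp add: less_le)
  qed
  have \<rho>: "0 < \<rho>" unfolding \<rho>_def using fin pos by (subst Min_gr_iff) auto
  have hole: "ennreal \<rho> * emeasure lborel (cell grid k) \<le> emeasure lborel (cell grid k - S)" if "k \<in> cells grid" for k
  proof -
    have "1 / real grid * (1 / real grid) \<le> 1" using grid_pos by (intro mult_le_one) auto
    then have "\<rho> * (1 / real grid * (1 / real grid)) \<le> \<rho>" using \<rho> by (intro mult_left_le) auto
    also have "\<dots> \<le> measure lborel (cell grid k - S)" unfolding \<rho>_def using fin that by (intro Min_le) auto
    finally have "ennreal (\<rho> * (1 / real grid * (1 / real grid))) \<le> ennreal (measure lborel (cell grid k - S))" by (rule ennreal_leI)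
    then show ?thesis unfolding emeasure_cell[OF grid_pos] em using \<rho> by (subst ennreal_mult[symmetric]) auto
  qed
  obtain m k where mk: "0 < m" "k \<in> cells m" "emeasure lborel (cell m k - S) < ennreal (\<rho> / 2) * emeasure lborel (cell m k)"
    using dense_cell[OF cS S(2,4), of "\<rho> / 2"] \<rho> by auto
  have *: "real (fst k) + 1 \<le> real m" "real (snd k) + 1 \<le> real m" using mk(2) by (auto simp: Suc_le_eq)
  \<comment> \<open>The box is the cell almost filled by \<open>S\<close>;
    \<open>escape_fraction\<close> forces a larger hole in it than \<open>dense_cell\<close>
    permits.\<close>
  interpret boxed_tents c s h h' "real (fst k) / real m" "(real (fst k) + 1) / real m" "real (snd k) / real m" "(real (snd k) + 1) / real m"
    using * mk(1) by unfold_locales (auto simp: divide_strict_right_mono)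
  have "U = cell m k" unfolding U_def cell_def ..
  then have "ennreal (\<rho> / 2) * emeasure lborel (cell m k) \<le> emeasure lborel (cell m k - S)"
    using escape_fraction[OF S(1,3), of \<rho>] \<rho> hole by simp
  then show False using mk(3) by simp
qed

section \<open>Spreading of grid cells by the 50th iterate\<close>

lemma tent_pow_dyadic:
  assumes "k \<le> 2 ^ n" shows "(tent 2 ^^ n) (real k / 2 ^ n) = (if odd k then 1 else 0)"
  using assms
proof (induction n arbitrary: k)
  case 0
  then have "k = 0 \<or> k = 1" by auto
  then show ?case by auto
next
  case (Suc n)
  show ?case
  proof (cases "k \<le> 2 ^ n")
    case True
    then have "real k \<le> 2 ^ n" by (metis of_nat_le_iff of_nat_numeral of_nat_power)
    then have "tent 2 (real k / 2 ^ Suc n) = real k / 2 ^ n" by (simp add: tent_def abs_if field_simps)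
    then show ?thesis using Suc.IH[OF True] by (simp add: funpow_swap1 del: funpow.simps(2)) (simp add: funpow_swap1)
  next
    case False
    \<comment> \<open>The tent is symmetric about 1/2, and this reflection preserves the parity of
      the numerator.\<close>
    define l where "l = 2 ^ Suc n - k"
    have l: "l \<le> 2 ^ n" "real l = 2 * 2 ^ n - real k" "odd l \<longleftrightarrow> odd k"
      using False Suc.prems unfolding l_def by (auto simp: of_nat_diff)
    have "2 ^ n < real k" using False by (metis not_le of_nat_less_iff of_nat_numeral of_nat_power)
    then have "tent 2 (real k / 2 ^ Suc n) = real l / 2 ^ n" unfolding l(2) by (simp add: tent_def abs_if field_simps)
    then show ?thesis using Suc.IH[OF l(1)] l(3) by (simp add: funpow_swap1)
  qed
qed

text \<open>2^50 exceeds 3 * 4000^4, so a grid interval is longer than three dyadic steps and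
  contains two consecutive multiples of 2^-50, one with odd and one with even numerator.\<close>

lemma ex_dyadic:
  assumes "i < grid"
  shows "\<exists>a b. odd a \<and> even b \<and> a \<le> 2 ^ 50 \<and> b \<le> 2 ^ 50 \<and>
    {real a / 2 ^ 50, real b / 2 ^ 50} \<subseteq> {real i / real grid<..<(real i + 1) / real grid}"
proof -
  let ?y = "real i / real grid * 2 ^ 50"
  define k where "k = nat \<lfloor>?y\<rfloor> + 1"
  have g: "0 < real grid" "3 * real grid < 2 ^ 50" by (simp_all add: grid_def)
  have y0: "0 \<le> ?y" by simp
  have k: "?y < real k" "real k \<le> ?y + 1" unfolding k_def using y0 by (simp_all add: of_nat_nat) linarith+
  have "3 < 2 ^ 50 / real grid" using g by (simp add: less_divide_eq)
  then have k2: "real k + 1 < (real i + 1) / real grid * 2 ^ 50" using k by (simp add: add_divide_distrib distrib_right)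
  have "(real i + 1) / real grid \<le> 1" using assms g by (simp add: divide_le_eq)
  then have "(real i + 1) / real grid * 2 ^ 50 \<le> 1 * 2 ^ 50" by (intro mult_right_mono) auto
  then have "real (k + 1) < real (2 ^ 50)" using k2 by simp
  then have le: "k + 1 \<le> 2 ^ 50" by (simp only: of_nat_less_iff less_imp_le)
  have "real i / real grid < real k / 2 ^ 50" using k(1) by (simp add: less_divide_eq)
  moreover have "(real k + 1) / 2 ^ 50 < (real i + 1) / real grid" using k2 by (simp add: divide_less_eq)
  moreover have "real k / 2 ^ 50 < (real k + 1) / 2 ^ 50" by (simp add: divide_strict_right_mono)
  ultimately have in1: "real k / 2 ^ 50 \<in> {real i / real grid<..<(real i + 1) / real grid}"
    and in2: "real (k + 1) / 2 ^ 50 \<in> {real i / real grid<..<(real i + 1) / real grid}" by auto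
  show ?thesis
  proof (cases "odd k")
    case True
    then show ?thesis using in1 in2 le by (intro exI[of _ k] exI[of _ "k + 1"]) simp
  next
    case False
    then show ?thesis using in1 in2 le by (intro exI[of _ "k + 1"] exI[of _ k]) simp
  qed
qed

lemma tent_lipschitz: "\<bar>tent 2 x - tent 2 y\<bar> \<le> 2 * \<bar>x - y\<bar>"
proof -
  have "tent 2 x - tent 2 y = 2 * (\<bar>y - 1/2\<bar> - \<bar>x - 1/2\<bar>)" by (simp add: tent_def)
  moreover have "\<bar>\<bar>y - 1/2\<bar> - \<bar>x - 1/2\<bar>\<bar> \<le> \<bar>x - y\<bar>" using abs_triangle_ineq3[of "y - 1/2" "x - 1/2"] by simp
  ultimately show ?thesis by (simp only: abs_mult) simp
qed

text \<open>Coupling, slope defect and \<open>h\<close> each add at most 2^-60 per step, together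
  below 2^-58, and the full tent doubles the accumulated error. After 50 steps it is below
  2^-8.\<close>

locale nearly_full_tents = coupled_tents +
  assumes small: "c \<le> 1 / 2 ^ 60" "2 - s \<le> 1 / 2 ^ 60" "\<And>x. x \<in> {0..1} \<Longrightarrow> \<bar>h x\<bar> \<le> 1 / 2 ^ 60"
begin

lemma close_to_product:
  assumes x: "x \<in> unit_square"
  shows "\<bar>coord b ((T ^^ n) x) - (tent 2 ^^ n) (coord b x)\<bar> \<le> (2 ^ n - 1) * (1 / 2 ^ 58)"
proof (induction n)
  case (Suc n)
  let ?z = "coord b ((T ^^ n) x)" and ?t = "(tent 2 ^^ n) (coord b x)"
  have q: "(T ^^ n) x \<in> unit_square" using x by (rule T_pow_unit_square)
  have z: "?z \<in> {0..1}" using q by (auto simp: coord_def unit_square_def)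
  have "F ?z - tent 2 ?z = (2 - s) * \<bar>?z - 1/2\<bar> + h ?z" by (simp add: F_def tent_def algebra_simps)
  moreover have "\<bar>(2 - s) * \<bar>?z - 1/2\<bar>\<bar> \<le> 1 / 2 ^ 60 * 1"
    unfolding abs_mult using small(2) s_le z by (intro mult_mono) auto
  ultimately have "\<bar>F ?z - tent 2 ?z\<bar> \<le> 1 / 2 ^ 60 + 1 / 2 ^ 60" using small(3)[OF z] by linarith
  moreover have "\<bar>coord b (T ((T ^^ n) x)) - F ?z\<bar> \<le> 1 / 2 ^ 60" using coord_T[OF q, of b] small(1) by linarith
  moreover have "\<bar>tent 2 ?z - tent 2 ?t\<bar> \<le> 2 * \<bar>?z - ?t\<bar>" by (rule tent_lipschitz)
  moreover have "\<bar>u - y\<bar> \<le> \<bar>u - v\<bar> + \<bar>v - w\<bar> + \<bar>w - y\<bar>" for u v w y :: real by linarith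
  note this[of "coord b (T ((T ^^ n) x))" "tent 2 ?t" "F ?z" "tent 2 ?z"]
  ultimately have "\<bar>coord b (T ((T ^^ n) x)) - tent 2 ?t\<bar> \<le> 1 / 2 ^ 60 + (1 / 2 ^ 60 + 1 / 2 ^ 60) + 2 * \<bar>?z - ?t\<bar>"
    by (meson add_mono order_trans)
  also have "\<dots> \<le> 1 / 2 ^ 58 + 2 * \<bar>?z - ?t\<bar>" by simp
  also have "\<dots> \<le> 1 / 2 ^ 58 + 2 * ((2 ^ n - 1) * (1 / 2 ^ 58))" using Suc by simp
  also have "\<dots> = (2 ^ Suc n - 1) * (1 / 2 ^ 58)" by (simp add: field_simps)
  finally show ?case by simp
qed simp

text \<open>Fifty full tents send odd dyadics to 1 and even ones to 0. Pairing an odd coordinate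
  with an even one, in either order, gives a difference near 1 or near -1, with error at most 1/8
  per coordinate.\<close>

lemma cell_spreads:
  assumes k: "k \<in> cells grid"
  shows "\<exists>x\<in>cell grid k. 1/2 < fst ((T ^^ 50) x) - snd ((T ^^ 50) x)"
    and "\<exists>x\<in>cell grid k. fst ((T ^^ 50) x) - snd ((T ^^ 50) x) < - 1/2"
proof -
  obtain a b where ab: "odd a" "even b" "a \<le> 2 ^ 50" "b \<le> 2 ^ 50"
    "{real a / 2 ^ 50, real b / 2 ^ 50} \<subseteq> {real (fst k) / real grid<..<(real (fst k) + 1) / real grid}"
    using ex_dyadic[of "fst k"] k by auto
  obtain a' b' where ab': "odd a'" "even b'" "a' \<le> 2 ^ 50" "b' \<le> 2 ^ 50"
    "{real a' / 2 ^ 50, real b' / 2 ^ 50} \<subseteq> {real (snd k) / real grid<..<(real (snd k) + 1) / real grid}"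
    using ex_dyadic[of "snd k"] k by auto
  have e: "\<bar>coord v ((T ^^ 50) x) - (tent 2 ^^ 50) (coord v x)\<bar> \<le> 1/8" if "x \<in> cell grid k" for v x
  proof -
    have "x \<in> unit_square" using that cell_subset_unit_square[OF k] by blast
    then show ?thesis by (rule order_trans[OF close_to_product]) simp
  qed
  let ?x = "(real a / 2 ^ 50, real b' / 2 ^ 50)" and ?y = "(real b / 2 ^ 50, real a' / 2 ^ 50)"
  have in': "?x \<in> cell grid k" "?y \<in> cell grid k" using ab(5) ab'(5) unfolding cell_def by auto
  have t: "(tent 2 ^^ 50) (real a / 2 ^ 50) = 1" "(tent 2 ^^ 50) (real b / 2 ^ 50) = 0"
    "(tent 2 ^^ 50) (real a' / 2 ^ 50) = 1" "(tent 2 ^^ 50) (real b' / 2 ^ 50) = 0"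
    using tent_pow_dyadic[OF ab(3)] tent_pow_dyadic[OF ab(4)] tent_pow_dyadic[OF ab'(3)] tent_pow_dyadic[OF ab'(4)] ab(1,2) ab'(1,2)
    by (simp_all only: if_True if_False simp_thms)
  show "\<exists>x\<in>cell grid k. 1/2 < fst ((T ^^ 50) x) - snd ((T ^^ 50) x)"
  proof (rule bexI[OF _ in'(1)])
    have "\<bar>fst ((T ^^ 50) ?x) - 1\<bar> \<le> 1/8" "\<bar>snd ((T ^^ 50) ?x)\<bar> \<le> 1/8"
      using e[OF in'(1), of True] e[OF in'(1), of False] t by (simp_all only: coord_def if_True if_False fst_conv snd_conv diff_zero)
    then show "1/2 < fst ((T ^^ 50) ?x) - snd ((T ^^ 50) ?x)" by linarith
  qed
  show "\<exists>x\<in>cell grid k. fst ((T ^^ 50) x) - snd ((T ^^ 50) x) < - 1/2"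
  proof (rule bexI[OF _ in'(2)])
    have "\<bar>fst ((T ^^ 50) ?y)\<bar> \<le> 1/8" "\<bar>snd ((T ^^ 50) ?y) - 1\<bar> \<le> 1/8"
      using e[OF in'(2), of True] e[OF in'(2), of False] t by (simp_all only: coord_def if_True if_False fst_conv snd_conv diff_zero)
    then show "fst ((T ^^ 50) ?y) - snd ((T ^^ 50) ?y) < - 1/2" by linarith
  qed
qed

text \<open>The sign is kept so that a connected cell with gaps of both signs must contain a point
  of gap 0.\<close>

definition gap :: "nat \<Rightarrow> real \<times> real \<Rightarrow> real" where "gap n x = fst ((T ^^ n) x) - snd ((T ^^ n) x)"

lemma continuous_gap: "continuous_on A (gap n)"
  unfolding gap_def by (intro continuous_intros continuous_T_pow)

text \<open>The points whose gap stays in \<open>G\<close> forever form a closed forward invariant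
  set, which would contain a grid cell if it had positive area. Applying its nullity to
  \<open>(T ^^ N) x\<close> for every \<open>N\<close> yields escapes at arbitrarily late
  times.\<close>

lemma trapped_null:
  assumes "closed G" and no: "\<And>k. k \<in> cells grid \<Longrightarrow> \<exists>x\<in>cell grid k. gap 50 x \<notin> G"
  shows "AE x in lborel. x \<in> unit_square \<longrightarrow> (\<forall>N. \<exists>n\<ge>N. gap n x \<notin> G)"
proof -
  define S where "S = {x \<in> unit_square. \<forall>n. gap n x \<in> G}"
  have "S = unit_square \<inter> (\<Inter>n. gap n -` G)" by (auto simp: S_def)
  moreover have "closed unit_square" unfolding unit_square_def by (intro closed_Times) auto
  ultimately have cl: "closed S"
    using assms(1) by (auto intro!: closed_Int closed_INT closed_vimage continuous_gap)
  have inv: "T ` S \<subseteq> S"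
  proof
    fix y assume "y \<in> T ` S"
    then obtain x where x: "x \<in> S" "y = T x" by auto
    have "gap n y = gap (Suc n) x" for n unfolding gap_def x(2) by (simp add: funpow_swap1)
    then show "y \<in> S" using x T_unit_square by (auto simp: S_def)
  qed
  have "\<not> (\<exists>k\<in>cells grid. cell grid k \<subseteq> S)" using no unfolding S_def by blast
  then have "\<not> 0 < emeasure lborel S"
    using invariant_contains_cell[OF cl _ inv] unfolding S_def by blast
  then have "S \<in> null_sets lborel" using cl by (auto simp: null_sets_def)
  then have "AE x in lborel. x \<notin> S" by (rule AE_not_in)
  then have "AE x in lborel. \<forall>N. (T ^^ N) x \<notin> S" unfolding AE_all_countable by (intro allI AE_T_pow)
  then show ?thesis
  proof eventually_elim
    case (elim x)
    show ?case
    proof (intro impI allI)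
      fix N assume x: "x \<in> unit_square"
      then obtain n where "gap n ((T ^^ N) x) \<notin> G" using elim T_pow_unit_square unfolding S_def by blast
      moreover have "gap n ((T ^^ N) x) = gap (n + N) x" unfolding gap_def by (simp add: funpow_add)
      ultimately show "\<exists>n\<ge>N. gap n x \<notin> G" by (intro exI[of _ "n + N"]) simp
    qed
  qed
qed

lemma AE_gap_large: "AE x in lborel. x \<in> unit_square \<longrightarrow> (\<forall>N. \<exists>n\<ge>N. gap n x \<notin> {-1/2..1/2})"
  by (rule trapped_null) (use cell_spreads(1) in \<open>force simp: gap_def\<close>)+

text \<open>Every grid cell is connected and contains points with \<open>gap 50\<close> above 1/2
  and below -1/2, hence one where it vanishes.\<close>

lemma AE_gap_small:
  assumes "0 < \<epsilon>"
  shows "AE x in lborel. x \<in> unit_square \<longrightarrow> (\<forall>N. \<exists>n\<ge>N. gap n x \<notin> {..-\<epsilon>} \<union> {\<epsilon>..})"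
proof (rule trapped_null)
  fix k assume k: "k \<in> cells grid"
  obtain x y where xy: "x \<in> cell grid k" "y \<in> cell grid k" "1/2 < gap 50 x" "gap 50 y < - 1/2"
    using cell_spreads[OF k] unfolding gap_def by blast
  have "connected (cell grid k)"
    unfolding cell_def by (intro convex_connected convex_Times) auto
  then have "connected (gap 50 ` cell grid k)" by (rule connected_continuous_image[OF continuous_gap])
  then have "0 \<in> gap 50 ` cell grid k"
    using connectedD_interval[of "gap 50 ` cell grid k" "gap 50 y" "gap 50 x" 0] xy by auto
  then show "\<exists>x\<in>cell grid k. gap 50 x \<notin> {..-\<epsilon>} \<union> {\<epsilon>..}" using assms by force
qed auto

end

subsection \<open>Intermittency\<close>

text \<open>The derivative of \<open>g\<close> is continued by its endpoint values and integrated
  again. The result is affine outside the unit interval, and the bound on the second derivative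
  survives as a Lipschitz constant.\<close>

lemma C2_small_extension:
  assumes C2: "C2_on {0..1} g" and small: "C2_norm {0..1} g < \<eta>"
  obtains h h' where "\<And>x. (h has_real_derivative h' x) (at x)" "\<And>x. \<bar>h' x\<bar> \<le> \<eta>" "\<And>x y. \<bar>h' x - h' y\<bar> \<le> \<eta> * \<bar>x - y\<bar>"
    "\<And>x. x \<in> {0..1} \<Longrightarrow> h x = g x" "\<And>x. x \<in> {0..1} \<Longrightarrow> \<bar>g x\<bar> \<le> \<eta>"
proof -
  let ?I = "{0..1::real}"
  define g1 where "g1 = deriv_within ?I g"
  define g2 where "g2 = deriv_within ?I g1"
  have d: "g differentiable_on ?I" "g1 differentiable_on ?I" and c2: "continuous_on ?I g2"
    using C2 unfolding C2_on_def g1_def g2_def by auto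
  have D1: "(g has_real_derivative g1 x) (at x within ?I)" if "x \<in> ?I" for x
    using d(1) that unfolding g1_def deriv_within_def differentiable_on_def has_real_derivative_iff_has_vector_derivative
    by (simp add: vector_derivative_works)
  have D2: "(g1 has_real_derivative g2 x) (at x within ?I)" if "x \<in> ?I" for x
    using d(2) that unfolding g2_def deriv_within_def differentiable_on_def has_real_derivative_iff_has_vector_derivative
    by (simp add: vector_derivative_works)
  have sup: "\<bar>k x\<bar> \<le> (SUP x\<in>?I. \<bar>k x\<bar>)" if "continuous_on ?I k" "x \<in> ?I" for k :: "real \<Rightarrow> real" and x
  proof -
    have "compact ((\<lambda>x. \<bar>k x\<bar>) ` ?I)" using that(1) by (intro compact_continuous_image continuous_intros) auto
    then have "bdd_above ((\<lambda>x. \<bar>k x\<bar>) ` ?I)" by (intro bounded_imp_bdd_above compact_imp_bounded)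
    then show ?thesis using that(2) by (rule cSUP_upper2) simp
  qed
  have norm: "(SUP x\<in>?I. \<bar>g x\<bar>) < \<eta>" "(SUP x\<in>?I. \<bar>g1 x\<bar>) < \<eta>" "(SUP x\<in>?I. \<bar>g2 x\<bar>) < \<eta>"
    using small unfolding C2_norm_def g1_def g2_def by simp_all
  have c1: "continuous_on ?I g1" using d(2) by (rule differentiable_imp_continuous_on)
  have b: "\<bar>g x\<bar> \<le> \<eta>" "\<bar>g1 x\<bar> \<le> \<eta>" "\<bar>g2 x\<bar> \<le> \<eta>" if "x \<in> ?I" for x
    using sup[OF differentiable_imp_continuous_on[OF d(1)] that] sup[OF c1 that] sup[OF c2 that] norm by linarith+
  define cl where "cl x = max 0 (min 1 x)" for x :: real
  have cl: "cl x \<in> ?I" "\<bar>cl x - cl y\<bar> \<le> \<bar>x - y\<bar>" "x \<in> ?I \<Longrightarrow> cl x = x" for x y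
    unfolding cl_def by (auto simp: max_def min_def)
  define h' where "h' x = g1 (cl x)" for x
  have lip1: "\<bar>g1 x - g1 y\<bar> \<le> \<eta> * \<bar>x - y\<bar>" if "x \<in> ?I" "y \<in> ?I" for x y
    using field_differentiable_bound[of ?I g1 g2 \<eta> x y] D2 b(3) that by (simp add: convex_closed_interval)
  have "0 \<le> \<eta>" using b(1)[of 0] abs_ge_zero[of "g 0"] by simp
  then have lip: "\<bar>h' x - h' y\<bar> \<le> \<eta> * \<bar>x - y\<bar>" for x y
    unfolding h'_def using lip1[OF cl(1) cl(1), of x y] mult_left_mono[OF cl(2)[of x y], of \<eta>] by linarith
  have "continuous_on UNIV cl" unfolding cl_def by (intro continuous_intros)
  then have "continuous_on UNIV h'"
    unfolding h'_def by (rule continuous_on_compose2[OF c1]) (use cl(1) in auto)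
  then have "isCont h' x" for x by (simp add: continuous_on_eq_continuous_at)
  then obtain H where H: "\<And>x. (H has_vector_derivative h' x) (at x)"
    using einterval_antiderivative[of "-\<infinity>" "\<infinity>" h'] by auto
  define h where "h x = H x - (H 0 - g 0)" for x
  have dh: "(h has_real_derivative h' x) (at x)" for x
    unfolding h_def using H[of x] by (auto intro!: derivative_eq_intros simp: has_real_derivative_iff_has_vector_derivative[symmetric])
  have "((\<lambda>x. h x - g x) has_real_derivative 0) (at x within ?I)" if "x \<in> ?I" for x
    using DERIV_diff[OF has_field_derivative_at_within[OF dh] D1[OF that]] cl(3)[OF that] by (simp add: h'_def)
  then have "\<exists>k. \<forall>x\<in>?I. h x - g x = k"
    by (intro has_field_derivative_zero_constant) (auto simp: convex_closed_interval)
  then obtain k where k: "\<forall>x\<in>?I. h x - g x = k" by blast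
  have "k = 0" using k[rule_format, of 0] by (simp add: h_def)
  then have "h x = g x" if "x \<in> ?I" for x using k that by simp
  then show thesis using dh b cl lip that[of h h'] by (simp add: h'_def)
qed

text \<open>The factor 1/2 is a rough version of the exact 1 over the square root of 2. It turns a
  gap above 1/2 into a distance above 1/4, the value used for \<open>\<gamma>0\<close>.\<close>

lemma infdist_D_syn:
  assumes "x \<in> unit_square"
  shows "infdist x D_syn \<le> \<bar>fst x - snd x\<bar>" and "\<bar>fst x - snd x\<bar> / 2 \<le> infdist x D_syn"
proof -
  have d: "(fst x, fst x) \<in> D_syn" using assms by (auto simp: D_syn_def unit_square_def)
  have "dist x (fst x, fst x) = \<bar>fst x - snd x\<bar>" by (simp add: dist_prod_def dist_real_def abs_minus_commute)
  then show "infdist x D_syn \<le> \<bar>fst x - snd x\<bar>" using infdist_le[OF d, of x] by simp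
  have ne: "D_syn \<noteq> {}" using d by blast
  have L: "\<bar>fst x - snd x\<bar> / 2 \<le> dist x y" if "y \<in> D_syn" for y
  proof -
    have "fst y = snd y" using that by (auto simp: D_syn_def)
    then have "\<bar>fst x - snd x\<bar> \<le> \<bar>fst x - fst y\<bar> + \<bar>snd x - snd y\<bar>" by linarith
    also have "\<dots> \<le> dist x y + dist x y"
      using dist_fst_le[of x y] dist_snd_le[of x y] by (intro add_mono) (auto simp: dist_real_def)
    finally show ?thesis by simp
  qed
  show "\<bar>fst x - snd x\<bar> / 2 \<le> infdist x D_syn"
    unfolding infdist_notempty[OF ne] using L by (rule cINF_greatest[OF ne])
qed

lemma (in nearly_full_tents) AE_intermittent:
  "AE x in lborel. x \<in> unit_square \<longrightarrow>
    liminf (\<lambda>n. ereal (infdist ((T ^^ n) x) D_syn)) = 0 \<and> ereal (1/4) \<le> limsup (\<lambda>n. ereal (infdist ((T ^^ n) x) D_syn))"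
proof -
  \<comment> \<open>Countably many thresholds 1/(m+1) replace all positive
    \<open>\<epsilon>\<close>, so that a single null set is excluded.\<close>
  have "AE x in lborel. \<forall>m. x \<in> unit_square \<longrightarrow> (\<forall>N. \<exists>n\<ge>N. gap n x \<notin> {..-(1 / real (Suc m))} \<union> {1 / real (Suc m)..})"
    unfolding AE_all_countable by (intro allI AE_gap_small) simp
  then show ?thesis using AE_gap_large
  proof eventually_elim
    case (elim x)
    let ?d = "\<lambda>n. infdist ((T ^^ n) x) D_syn"
    show ?case
    proof (intro impI conjI)
      assume x: "x \<in> unit_square"
      note bd = infdist_D_syn[OF T_pow_unit_square[OF x], folded gap_def]
      have li: "liminf (\<lambda>n. ereal (?d n)) \<le> ereal \<epsilon>" if \<epsilon>: "0 < \<epsilon>" for \<epsilon>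
      proof (rule ccontr)
        assume "\<not> ?thesis"
        then have "ereal \<epsilon> < liminf (\<lambda>n. ereal (?d n))" by simp
        then have "\<forall>\<^sub>F n in sequentially. ereal \<epsilon> < ereal (?d n)" by (rule less_LiminfD)
        then obtain N where N: "\<And>n. n \<ge> N \<Longrightarrow> \<epsilon> < ?d n" unfolding eventually_sequentially by auto
        obtain m where m: "1 / real (Suc m) < \<epsilon>" using reals_Archimedean[OF \<epsilon>] by (auto simp: inverse_eq_divide)
        obtain n where "n \<ge> N" "gap n x \<notin> {..-(1 / real (Suc m))} \<union> {1 / real (Suc m)..}" using elim(1) x by blast
        then have "n \<ge> N" "\<bar>gap n x\<bar> < 1 / real (Suc m)" by (auto simp: abs_less_iff)
        then show False using N[of n] bd(1)[of n] m by simp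
      qed
      have "liminf (\<lambda>n. ereal (?d n)) \<le> 0"
      proof (rule ereal_le_epsilon2)
        fix \<epsilon> :: real assume "0 < \<epsilon>"
        then show "liminf (\<lambda>n. ereal (?d n)) \<le> 0 + ereal \<epsilon>" using li by simp
      qed
      moreover have "0 \<le> liminf (\<lambda>n. ereal (?d n))"
        by (intro Liminf_bounded always_eventually allI) (simp add: infdist_nonneg)
      ultimately show "liminf (\<lambda>n. ereal (?d n)) = 0" by (rule antisym)
      show "ereal (1/4) \<le> limsup (\<lambda>n. ereal (?d n))"
      proof (rule ccontr)
        assume "\<not> ?thesis"
        then have "limsup (\<lambda>n. ereal (?d n)) < ereal (1/4)" by simp
        then have "\<forall>\<^sub>F n in sequentially. ereal (?d n) < ereal (1/4)" by (rule Limsup_lessD)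
        then obtain N where N: "\<And>n. n \<ge> N \<Longrightarrow> ?d n < 1/4" unfolding eventually_sequentially by auto
        obtain n where "n \<ge> N" "gap n x \<notin> {-1/2..1/2}" using elim(2) x by blast
        then have "n \<ge> N" "1/2 < \<bar>gap n x\<bar>" by auto
        then show False using N[of n] bd(2)[of n] by simp
      qed
    qed
  qed
qed

theorem theorem1p2:
  shows "\<exists>(c_plus::real) (s0_plus::real) (\<eta>::real).
    0 < c_plus \<and> c_plus \<le> 1 \<and> 0 < s0_plus \<and> 0 < \<eta> \<and>
    (\<forall>(c::real) (s0::real) (g::real \<Rightarrow> real) (f::real \<Rightarrow> real).
       0 \<le> s0 \<and> s0 < 1 \<and>
       C2_on {0..1} g \<and>
       f = (\<lambda>x. tent (2 - s0) x + g x) \<and>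
       (\<forall>x\<in>{0..1}. f x \<in> {0..1}) \<and>
       0 \<le> c \<and> c < c_plus \<and> s0 \<le> s0_plus \<and> C2_norm {0..1} g < \<eta> \<longrightarrow>
       (\<exists>\<gamma>0::real. 0 < \<gamma>0 \<and>
         (AE x in lebesgue_on unit_square.
            liminf (\<lambda>n. ereal (infdist ((coupled_map c f ^^ n) x) D_syn)) = 0 \<and>
            limsup (\<lambda>n. ereal (infdist ((coupled_map c f ^^ n) x) D_syn)) \<ge> ereal \<gamma>0)))"
proof -
  \<comment> \<open>The tolerance of \<open>nearly_full_tents\<close> serves for all three
    constants.\<close>
  let ?\<delta> = "1 / 2 ^ 60 :: real"
  have main: "\<exists>\<gamma>0::real. 0 < \<gamma>0 \<and>
         (AE x in lebesgue_on unit_square.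
            liminf (\<lambda>n. ereal (infdist ((coupled_map c f ^^ n) x) D_syn)) = 0 \<and>
            limsup (\<lambda>n. ereal (infdist ((coupled_map c f ^^ n) x) D_syn)) \<ge> ereal \<gamma>0)"
    if s0: "0 \<le> s0" "s0 \<le> ?\<delta>" and g: "C2_on {0..1} g" "C2_norm {0..1} g < ?\<delta>" and c: "0 \<le> c" "c < ?\<delta>"
      and f: "f = (\<lambda>x. tent (2 - s0) x + g x)" "\<forall>x\<in>{0..1}. f x \<in> {0..1}" for c s0 g f
  proof -
    obtain h h' where h: "\<And>x. (h has_real_derivative h' x) (at x)" "\<And>x. \<bar>h' x\<bar> \<le> ?\<delta>" "\<And>x y. \<bar>h' x - h' y\<bar> \<le> ?\<delta> * \<bar>x - y\<bar>"
      "\<And>x. x \<in> {0..1} \<Longrightarrow> h x = g x" "\<And>x. x \<in> {0..1} \<Longrightarrow> \<bar>g x\<bar> \<le> ?\<delta>"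
      using C2_small_extension[OF g] by blast
    have le: "?\<delta> \<le> 1/1000" by simp
    interpret nearly_full_tents c "2 - s0" h h'
    proof unfold_locales
      fix x y
      have "?\<delta> * \<bar>x - y\<bar> \<le> 1/1000 * \<bar>x - y\<bar>" using le by (rule mult_right_mono) simp
      then show "\<bar>h' x - h' y\<bar> \<le> 1/1000 * \<bar>x - y\<bar>" using h(3)[of x y] by (rule order_trans[rotated])
    next
      fix x :: real assume x: "x \<in> {0..1}"
      show "\<bar>h x\<bar> \<le> ?\<delta>" using h(4,5)[OF x] by simp
      then show "\<bar>h x\<bar> \<le> 1/1000" using le by (rule order_trans)
      show "tent (2 - s0) x + h x \<in> {0..1}" using f x h(4)[OF x] by simp
    next
      fix x show "\<bar>h' x\<bar> \<le> 1/1000" using h(2) le by (rule order_trans)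
    qed (use s0 c le h(1) in \<open>simp_all\<close>)
    \<comment> \<open>\<open>f\<close> and \<open>F\<close> are known to agree only on the unit
      interval; forward invariance of the square carries this over to all iterates.\<close>
    have Fx: "f x = F x" if "x \<in> {0..1}" for x using that f(1) h(4) by (simp add: F_def)
    have step: "coupled_map c f x = T x" if "x \<in> unit_square" for x
      using that Fx by (cases x) (simp add: T_def coupled_map_def unit_square_def)
    have pow: "(coupled_map c f ^^ n) x = (T ^^ n) x" if "x \<in> unit_square" for n x
    proof (induction n)
      case (Suc n)
      then show ?case using step[OF T_pow_unit_square[OF that, of n]] by simp
    qed simp
    have ae: "AE x in lebesgue. x \<in> unit_square \<longrightarrow>
      liminf (\<lambda>n. ereal (infdist ((coupled_map c f ^^ n) x) D_syn)) = 0 \<and> ereal (1/4) \<le> limsup (\<lambda>n. ereal (infdist ((coupled_map c f ^^ n) x) D_syn))"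
      using AE_completion[OF AE_intermittent] by eventually_elim (simp add: pow)
    have "unit_square \<in> sets lebesgue"
      using closed_Times[OF closed_atLeastAtMost[of "0::real" 1] closed_atLeastAtMost[of "0::real" 1]]
      unfolding unit_square_def by (intro sets_completionI_sets) simp
    then have "AE x in lebesgue_on unit_square.
      liminf (\<lambda>n. ereal (infdist ((coupled_map c f ^^ n) x) D_syn)) = 0 \<and> ereal (1/4) \<le> limsup (\<lambda>n. ereal (infdist ((coupled_map c f ^^ n) x) D_syn))"
      by (subst AE_restrict_space_iff) (simp, rule ae)
    then show ?thesis by (intro exI[of _ "1/4"] conjI) simp
  qed
  show ?thesis
    by (rule exI[of _ ?\<delta>], rule exI[of _ ?\<delta>], rule exI[of _ ?\<delta>]) (use main in \<open>intro conjI allI impI; (elim conjE)?; simp?\<close>)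
qed

end
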